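(* Let $R\ge 1$, let $\hat{x}_0\in\mathbb{S}^2$ and $\delta>0$ be fixed, and let $K>1$. Let $f\in L^2(\mathbb{R}^3)$ with $\operatorname{supp} f\subset B_R$ and set $M_0=\|f\|_{L^2(\mathbb{R}^3)}$. Let $u\in H^2_{loc}(\mathbb{R}^3)$ be the unique radiating solution of $(\Delta+k^2)u=-f$ in $\mathbb{R}^3$, with far-field pattern $u^\infty(\hat{x},k)$, and assume $$\epsilon:=\|u^{\infty}\|_{L^{\infty}(\mathcal{V}_\delta(\hat{x}_0)\times (0,K))}<1.$$ Then there exist $\alpha\in(0,1)$ (depending only on $R$ and $\delta$) and a constant $C>0$ independent of $K$ such that $$\|f\|^2_{H^{-1}(\mathbb{R}^3)}\leq C\left[ K^3e^{2K(1-\alpha)}\epsilon^{2\alpha}+\frac{M_0^2}{K^{4/3}|\ln\epsilon|^{1/2}}\right].$$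
   Context: $B_R=\{x\in\mathbb{R}^3:|x|<R\}$. For $k>0$, $u$ denotes the unique solution of $(\Delta+k^2)u=-f$ in $\mathbb{R}^3$ satisfying the Sommerfeld radiation condition $\lim_{r=|x|\to\infty} r(\partial_r u-iku)=0$; its far-field pattern is $u^\infty(\hat{x},k)=\int_{\mathbb{R}^3}e^{-ik\hat{x}\cdot y}f(y)\,dy$, $\hat{x}\in\mathbb{S}^2$. $\mathcal{V}_\delta(\hat{x}_0)=\{\hat{x}\in\mathbb{S}^2:|\hat{x}-\hat{x}_0|<\delta\}$. The Fourier transform is $\hat f(\xi)=(2\pi)^{-3/2}\int_{\mathbb{R}^3}f(x)e^{-i\xi\cdot x}dx$ and $\|f\|^2_{H^{-1}(\mathbb{R}^3)}=\int_{\mathbb{R}^3}(1+|\xi|^2)^{-1}|\hat f(\xi)|^2d\xi$. *)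

theory Defs
  imports "HOL-Analysis.Analysis"
begin

definition sphere2 :: "(real^3) set" where
  "sphere2 = {x. norm x = 1}"

definition Vdelta :: "real \<Rightarrow> real^3 \<Rightarrow> (real^3) set" where
  "Vdelta \<delta> x0 = {x \<in> sphere2. norm (x - x0) < \<delta>}"

definition far_field :: "(real^3 \<Rightarrow> complex) \<Rightarrow> real^3 \<Rightarrow> real \<Rightarrow> complex" where
  "far_field f xh k = (LINT y|lebesgue. cis (- (k * (xh \<bullet> y))) * f y)"

definition fourier3 :: "(real^3 \<Rightarrow> complex) \<Rightarrow> real^3 \<Rightarrow> complex" where
  "fourier3 f \<xi> = complex_of_real ((2 * pi) powr (-3/2)) *
      (LINT x|lebesgue. f x * cis (- (\<xi> \<bullet> x)))"

definition Hm1_norm_sq :: "(real^3 \<Rightarrow> complex) \<Rightarrow> real" where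
  "Hm1_norm_sq f = (LINT \<xi>|lebesgue. (cmod (fourier3 f \<xi>))\<^sup>2 / (1 + (norm \<xi>)\<^sup>2))"

definition L2_norm_sq :: "(real^3 \<Rightarrow> complex) \<Rightarrow> real" where
  "L2_norm_sq f = (LINT x|lebesgue. (cmod (f x))\<^sup>2)"

text \<open>L^infinity norm of the far field on V_delta(x0) x (0,K) (u_inf is continuous, so the
  essential supremum equals the supremum).\<close>
definition eps_data :: "(real^3 \<Rightarrow> complex) \<Rightarrow> real \<Rightarrow> real^3 \<Rightarrow> real \<Rightarrow> real" where
  "eps_data f \<delta> x0 K = (SUP p \<in> Vdelta \<delta> x0 \<times> {0<..<K}. cmod (far_field f (fst p) (snd p)))"

end

theory Submission
  imports Defs "HOL-Probability.Characteristic_Functions"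
begin

text \<open>
  Write \<open>F\<close> for the unnormalised Fourier transform of \<open>f\<close>. The data bound \<open>F\<close> by \<open>\<epsilon>\<close> on a truncated
  cone, which contains a ball around \<open>p = (T/2) x\<^sub>0\<close>, \<open>T = min A K\<close>, of radius proportional to \<open>T\<close>.
  For \<open>|\<xi>| \<le> A\<close>, Newton's forward difference formula along the segment from \<open>p\<close> to \<open>\<xi>\<close> with nodes in
  this ball extrapolates the smallness: applied to the character \<open>z = exp (- i (\<xi> - p) \<cdot> x / N)\<close> it
  is the binomial expansion of \<open>z\<^sup>N = (1 + (z - 1))\<^sup>N\<close>, cut off after \<open>n\<close> terms with \<open>n\<close> proportional
  to \<open>A\<close>. This gives \<open>|F \<xi>| \<le> \<epsilon> exp (c (A + A\<^sup>2/K)) + exp (- A) \<parallel>f\<parallel>\<^sub>1\<close>. Frequencies above \<open>A\<close>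
  contribute at most \<open>M\<^sub>0\<^sup>2/A\<^sup>2\<close> by Plancherel's inequality. The choice
  \<open>A\<^sup>2 = K\<^bsup>4/3\<^esup> |ln \<epsilon>|\<^bsup>1/2\<^esup>\<close> yields the claim with \<open>\<alpha> = 1/2\<close>, because both \<open>A\<close> and \<open>A\<^sup>2/K\<close> grow
  sublinearly in \<open>max K |ln \<epsilon>|\<close>.
\<close>

section \<open>Plancherel's inequality\<close>

lemma has_bochner_integral_gaussian_cis:
  fixes \<sigma> u :: real
  assumes "\<sigma> > 0"
  shows "has_bochner_integral lborel
           (\<lambda>t. exp (complex_of_real (- (t / \<sigma>)\<^sup>2 / 2) + \<i> * complex_of_real (t * u)))
           (complex_of_real (\<sigma> * sqrt (2 * pi) * exp (- (\<sigma> * u)\<^sup>2 / 2)))"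
proof -
  let ?g = "\<lambda>x. std_normal_density x *\<^sub>R iexp (\<sigma> * u * x)"
  have int: "integrable lborel ?g"
  proof (rule Bochner_Integration.integrable_bound)
    show "integrable lborel std_normal_density" by (rule integrable_normal_density) simp
  qed (auto simp: norm_mult)
  \<comment> \<open>The closed form of the characteristic function of the standard normal law
    supplies the value; multiplying by \<open>sqrt (2 * pi)\<close> and substituting
    \<open>x = t / \<sigma>\<close> turns it into the claim.\<close>
  have "(CLINT x|lborel. ?g x) = char std_normal_distribution (\<sigma> * u)"
    unfolding char_def by (subst integral_density) auto
  then have "has_bochner_integral lborel ?g (exp (- (\<sigma> * u)\<^sup>2 / 2))"
    using int by (simp add: has_bochner_integral_iff char_std_normal_distribution)
  from has_bochner_integral_mult_right[OF this, of "complex_of_real (sqrt (2 * pi))"]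
  have "has_bochner_integral lborel (\<lambda>x. complex_of_real (sqrt (2 * pi)) * ?g x)
    (complex_of_real (sqrt (2 * pi)) * exp (- (\<sigma> * u)\<^sup>2 / 2))" by blast
  also have "(\<lambda>x. complex_of_real (sqrt (2 * pi)) * ?g x) =
      (\<lambda>x. exp (complex_of_real (- x\<^sup>2 / 2) + \<i> * complex_of_real (\<sigma> * x * u)))"
    by (intro ext) (simp only: exp_add, simp add: std_normal_density_def exp_of_real [symmetric] scaleR_conv_of_real mult_ac)
  finally have "has_bochner_integral lborel
      (\<lambda>x. exp (complex_of_real (- x\<^sup>2 / 2) + \<i> * complex_of_real (\<sigma> * x * u)))
      (complex_of_real (sqrt (2 * pi)) * exp (- (\<sigma> * u)\<^sup>2 / 2))" .
  from lborel_has_bochner_integral_real_affine_iff[of "1 / \<sigma>", THEN iffD1, OF _ this, of 0]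
  have "has_bochner_integral lborel
      (\<lambda>t. exp (complex_of_real (- (t / \<sigma>)\<^sup>2 / 2) + \<i> * complex_of_real (t * u)))
      (\<sigma> *\<^sub>R (complex_of_real (sqrt (2 * pi)) * exp (- (\<sigma> * u)\<^sup>2 / 2)))"
    using assms by simp
  then show ?thesis by (simp add: scaleR_conv_of_real mult_ac exp_of_real)
qed

text \<open>\<open>lborel\<close> on a Euclidean space is the image of the product measure over the
  coordinates, so the product formula for finite families applies.\<close>

lemma has_bochner_integral_lborel_prod:
  fixes g :: "'a::euclidean_space \<Rightarrow> real \<Rightarrow> complex"
  assumes "\<And>b. b \<in> Basis \<Longrightarrow> has_bochner_integral lborel (g b) (I b)"
  shows "has_bochner_integral lborel (\<lambda>x. \<Prod>b\<in>Basis. g b (x \<bullet> b)) (\<Prod>b\<in>Basis. I b)"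
proof -
  interpret product_sigma_finite "\<lambda>_::'a. lborel :: real measure" ..
  have g: "integrable lborel (g b)" "integral\<^sup>L lborel (g b) = I b" if "b \<in> Basis" for b
    using assms[OF that] by (auto simp: has_bochner_integral_iff)
  have [measurable]: "g b \<in> borel_measurable borel" if "b \<in> Basis" for b
    using g(1)[OF that] by auto
  have "has_bochner_integral (\<Pi>\<^sub>M b\<in>Basis. lborel) (\<lambda>x. \<Prod>b\<in>Basis. g b (x b)) (\<Prod>b\<in>Basis. I b)"
    unfolding has_bochner_integral_iff
    by (auto simp: g product_integral_prod intro!: product_integrable_prod)
  then show ?thesis
    unfolding has_bochner_integral_iff lborel_def[where 'a='a] lborel_eq_real
    by (subst integrable_distr_eq integral_distr, measurable)+
qed

text \<open>Both the squared norm and the inner product are sums over the coordinates, so the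
  integrand factors into one-dimensional Gaussians.\<close>

lemma has_bochner_integral_gaussian_cis_euclidean:
  fixes v :: "'a::euclidean_space"
  assumes "\<sigma> > 0"
  shows "has_bochner_integral lborel
           (\<lambda>\<xi>. complex_of_real (exp (- (norm \<xi> / \<sigma>)\<^sup>2 / 2)) * cis (\<xi> \<bullet> v))
           (complex_of_real ((\<sigma> * sqrt (2 * pi)) ^ DIM('a) * exp (- (\<sigma> * norm v)\<^sup>2 / 2)))"
proof -
  have norm2: "(norm x)\<^sup>2 = (\<Sum>b\<in>Basis. (x \<bullet> b)\<^sup>2)" for x :: 'a
    unfolding power2_norm_eq_inner by (subst euclidean_inner) (simp add: power2_eq_square)
  have "has_bochner_integral lborel
      (\<lambda>\<xi>. \<Prod>b\<in>Basis. exp (complex_of_real (- ((\<xi> \<bullet> b) / \<sigma>)\<^sup>2 / 2) + \<i> * complex_of_real ((\<xi> \<bullet> b) * (v \<bullet> b))))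
      (\<Prod>b\<in>Basis. complex_of_real (\<sigma> * sqrt (2 * pi) * exp (- (\<sigma> * (v \<bullet> b))\<^sup>2 / 2)))"
    by (intro has_bochner_integral_lborel_prod has_bochner_integral_gaussian_cis assms)
  also have "(\<lambda>\<xi>. \<Prod>b\<in>Basis. exp (complex_of_real (- ((\<xi> \<bullet> b) / \<sigma>)\<^sup>2 / 2) + \<i> * complex_of_real ((\<xi> \<bullet> b) * (v \<bullet> b)))) =
      (\<lambda>\<xi>. complex_of_real (exp (- (norm \<xi> / \<sigma>)\<^sup>2 / 2)) * cis (\<xi> \<bullet> v))"
  proof
    fix \<xi> :: 'a
    have "(\<Prod>b\<in>Basis. exp (complex_of_real (- ((\<xi> \<bullet> b) / \<sigma>)\<^sup>2 / 2) + \<i> * complex_of_real ((\<xi> \<bullet> b) * (v \<bullet> b))))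
       = exp (\<Sum>b\<in>Basis. complex_of_real (- ((\<xi> \<bullet> b) / \<sigma>)\<^sup>2 / 2) + \<i> * complex_of_real ((\<xi> \<bullet> b) * (v \<bullet> b)))"
      by (rule exp_sum[symmetric]) simp
    also have "(\<Sum>b\<in>Basis. complex_of_real (- ((\<xi> \<bullet> b) / \<sigma>)\<^sup>2 / 2) + \<i> * complex_of_real ((\<xi> \<bullet> b) * (v \<bullet> b)))
       = complex_of_real (- (norm \<xi> / \<sigma>)\<^sup>2 / 2) + \<i> * complex_of_real (\<xi> \<bullet> v)"
      unfolding power_divide norm2 euclidean_inner[of \<xi> v]
      by (simp add: sum.distrib sum_distrib_left sum_divide_distrib sum_subtractf)
    finally show "(\<Prod>b\<in>Basis. exp (complex_of_real (- ((\<xi> \<bullet> b) / \<sigma>)\<^sup>2 / 2) + \<i> * complex_of_real ((\<xi> \<bullet> b) * (v \<bullet> b))))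
        = complex_of_real (exp (- (norm \<xi> / \<sigma>)\<^sup>2 / 2)) * cis (\<xi> \<bullet> v)"
      by (simp only: exp_add cis_conv_exp exp_of_real)
  qed
  also have "(\<Prod>b\<in>Basis. complex_of_real (\<sigma> * sqrt (2 * pi) * exp (- (\<sigma> * (v \<bullet> b))\<^sup>2 / 2)))
      = complex_of_real ((\<sigma> * sqrt (2 * pi)) ^ DIM('a) * exp (- (\<sigma> * norm v)\<^sup>2 / 2))"
    unfolding of_real_prod [symmetric] prod.distrib power_mult_distrib norm2
    by (simp add: exp_sum [symmetric] sum_distrib_left sum_divide_distrib sum_negf power_mult_distrib)
  finally show ?thesis .
qed

text \<open>The case \<open>v = 0\<close> of the previous formula at width
  \<open>1 / \<sigma>\<close>, moved to \<open>a\<close> by translation invariance. It gives the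
  mass of the kernel \<open>k\<close> below in each of its variables.\<close>

lemma nn_integral_gaussian_euclidean:
  assumes "\<sigma> > 0"
  shows "(\<integral>\<^sup>+x. ennreal (exp (- (\<sigma> * norm (x - a :: 'a::euclidean_space))\<^sup>2 / 2)) \<partial>lborel) = ennreal ((sqrt (2 * pi) / \<sigma>) ^ DIM('a))"
proof -
  have "has_bochner_integral lborel (\<lambda>x::'a. complex_of_real (exp (- (\<sigma> * norm x)\<^sup>2 / 2)))
           (complex_of_real ((sqrt (2 * pi) / \<sigma>) ^ DIM('a)))"
    using has_bochner_integral_gaussian_cis_euclidean[of "1/\<sigma>" "0::'a"] assms by (simp add: mult_ac)
  then have "has_bochner_integral lborel (\<lambda>x::'a. exp (- (\<sigma> * norm x)\<^sup>2 / 2)) ((sqrt (2 * pi) / \<sigma>) ^ DIM('a))"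
    using has_bochner_integral_bounded_linear[OF bounded_linear_Re] by fastforce
  then have "(\<integral>\<^sup>+x. ennreal (exp (- (\<sigma> * norm (x::'a))\<^sup>2 / 2)) \<partial>lborel) = ennreal ((sqrt (2 * pi) / \<sigma>) ^ DIM('a))"
    by (subst nn_integral_eq_integral) (auto simp: has_bochner_integral_iff)
  moreover have "(\<integral>\<^sup>+x. ennreal (exp (- (\<sigma> * norm (x - a))\<^sup>2 / 2)) \<partial>lborel) = (\<integral>\<^sup>+x. ennreal (exp (- (\<sigma> * norm (x::'a))\<^sup>2 / 2)) \<partial>lborel)"
    by (subst lborel_distr_plus[of "-a", symmetric], subst nn_integral_distr) (auto simp: algebra_simps)
  ultimately show ?thesis by simp
qed

section \<open>Plancherel's inequality by Gaussian regularisation\<close>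

lemma pair_integrable_mult:
  fixes f :: "'a::euclidean_space \<Rightarrow> complex" and g :: "'b::euclidean_space \<Rightarrow> complex"
  assumes f: "integrable lborel f" and g: "integrable lborel g"
  shows "integrable (lborel \<Otimes>\<^sub>M lborel) (\<lambda>(x, y). f x * g y)"
proof -
  have [measurable]: "f \<in> borel_measurable borel" "g \<in> borel_measurable borel" using f g by auto
  show ?thesis
    by (rule lborel_pair.Fubini_integrable) (auto simp: norm_mult f g)
qed

lemma pair_integral_mult:
  fixes f :: "'a::euclidean_space \<Rightarrow> complex" and g :: "'b::euclidean_space \<Rightarrow> complex"
  assumes f: "integrable lborel f" and g: "integrable lborel g"
  shows "(LINT p|(lborel \<Otimes>\<^sub>M lborel). (\<lambda>(x, y). f x * g y) p) = (LINT x|lborel. f x) * (LINT y|lborel. g y)"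
proof -
  show ?thesis
    using lborel_pair.integral_fst'[OF pair_integrable_mult[OF f g]] by simp
qed

text \<open>Schur's test. Writing the squared modulus of the transform as a double integral and
  integrating the weight over the frequency first leaves the Gaussian kernel \<open>S * k\<close>,
  whose integral in either variable is \<open>(2 * pi) ^ DIM('a)\<close> for every \<sigma>.\<close>

lemma plancherel_le_gaussian:
  fixes f :: "'a::euclidean_space \<Rightarrow> complex"
  assumes f: "integrable lborel f" and f2: "integrable lborel (\<lambda>x. (cmod (f x))\<^sup>2)" and \<sigma>: "\<sigma> > 0"
  shows "(\<integral>\<^sup>+\<xi>. ennreal (exp (- (norm \<xi> / \<sigma>)\<^sup>2 / 2) * (cmod (LINT x|lborel. f x * cis (- (\<xi> \<bullet> x))))\<^sup>2) \<partial>lborel)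
     \<le> ennreal ((2 * pi) ^ DIM('a) * (LINT x|lborel. (cmod (f x))\<^sup>2))"
proof -
  have [measurable]: "f \<in> borel_measurable borel" using f by auto
  define F where "F \<xi> = (LINT x|lborel. f x * cis (- (\<xi> \<bullet> x)))" for \<xi>
  define g where "g \<xi> = exp (- (norm \<xi> / \<sigma>)\<^sup>2 / 2)" for \<xi> :: 'a
  define k where "k = (\<lambda>(x, y). exp (- (\<sigma> * norm (y - x :: 'a))\<^sup>2 / 2))"
  define h where "h = (\<lambda>(x, y). f x * cnj (f y))"
  \<comment> \<open>The weighted integrand over a frequency and a pair of points. The Gaussian
    factor makes it jointly integrable, which allows the order of integration to be
    exchanged.\<close>
  define H where "H = (\<lambda>(\<xi>, p). complex_of_real (g \<xi>) * (h p * cis (\<xi> \<bullet> (snd p - fst p))))"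
  define S where "S = (\<sigma> * sqrt (2 * pi)) ^ DIM('a)"
  have S: "S > 0" unfolding S_def using \<sigma> by simp
  have [measurable]: "cis \<in> borel_measurable borel"
    unfolding cis_conv_exp by (intro borel_measurable_continuous_onI continuous_intros)
  have [measurable]: "cnj \<in> borel_measurable borel"
    by (intro borel_measurable_continuous_onI continuous_intros)
  have [measurable]: "g \<in> borel_measurable borel" "k \<in> borel_measurable borel" "h \<in> borel_measurable borel"
    unfolding g_def k_def h_def borel_prod[symmetric] by measurable
  have [measurable]: "k \<in> borel_measurable (borel \<Otimes>\<^sub>M borel)"
    unfolding k_def by measurable
  have [measurable]: "H \<in> borel_measurable (lborel \<Otimes>\<^sub>M lborel)"
  proof -
    have "(\<lambda>p. snd p - fst p) \<in> borel_measurable (borel :: ('a \<times> 'a) measure)"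
      by (intro borel_measurable_continuous_onI continuous_intros)
    then have [measurable]: "(\<lambda>q :: 'a \<times> 'a \<times> 'a. snd (snd q) - fst (snd q)) \<in> borel_measurable (lborel \<Otimes>\<^sub>M lborel)"
      by (intro measurable_compose[of snd _ borel "\<lambda>p. snd p - fst p"]) auto
    show ?thesis unfolding H_def by measurable
  qed
  have g0: "g \<xi> > 0" for \<xi> unfolding g_def by simp
  have intg: "integrable lborel g"
  proof -
    have "integrable lborel (\<lambda>\<xi>. complex_of_real (g \<xi>) * cis (\<xi> \<bullet> 0))"
      using has_bochner_integral_gaussian_cis_euclidean[OF \<sigma>, of "0::'a"]
      unfolding g_def has_bochner_integral_iff by blast
    then show ?thesis using complex_of_real_integrable_eq by auto
  qed
  have inth: "integrable lborel h"
  proof -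
    have "integrable (lborel \<Otimes>\<^sub>M lborel) (\<lambda>(x, y). f x * cnj (f y))"
      using f by (intro pair_integrable_mult) auto
    then show ?thesis by (simp add: h_def lborel_prod)
  qed
  have intH: "integrable (lborel \<Otimes>\<^sub>M lborel) H"
  proof (rule Bochner_Integration.integrable_bound)
    show "integrable (lborel \<Otimes>\<^sub>M lborel) (\<lambda>(\<xi>, p). complex_of_real (g \<xi>) * h p)"
      using intg inth by (intro pair_integrable_mult) auto
    show "AE q in lborel \<Otimes>\<^sub>M lborel. cmod (H q) \<le> cmod (case q of (\<xi>, p) \<Rightarrow> complex_of_real (g \<xi>) * h p)"
      by (auto simp: H_def norm_mult)
  qed measurable
  have Hg: "(LINT p|lborel. H (\<xi>, p)) = complex_of_real (g \<xi> * (cmod (F \<xi>))\<^sup>2)" for \<xi>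
  proof -
    have i: "integrable lborel (\<lambda>x. f x * cis (- (\<xi> \<bullet> x)))"
      by (rule Bochner_Integration.integrable_bound[OF f]) (auto simp: norm_mult)
    have "(LINT p|lborel. h p * cis (\<xi> \<bullet> (snd p - fst p))) =
       (LINT p|(lborel \<Otimes>\<^sub>M lborel). (\<lambda>(x, y). (f x * cis (- (\<xi> \<bullet> x))) * cnj (f y * cis (- (\<xi> \<bullet> y)))) p)"
      unfolding lborel_prod
      by (intro Bochner_Integration.integral_cong) (auto simp: h_def cis_cnj mult_ac inner_diff_right cis_mult)
    also have "\<dots> = F \<xi> * (LINT y|lborel. cnj (f y * cis (- (\<xi> \<bullet> y))))"
      unfolding F_def using i by (intro pair_integral_mult i integrable_cnj)
    also have "(LINT y|lborel. cnj (f y * cis (- (\<xi> \<bullet> y)))) = cnj (F \<xi>)"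
      unfolding F_def by (rule integral_bounded_linear[OF bounded_linear_cnj i])
    finally show ?thesis
      unfolding H_def using complex_norm_square[of "F \<xi>"] by simp
  qed
  have Hx: "(LINT \<xi>|lborel. H (\<xi>, p)) = h p * complex_of_real (S * k p)" for p
  proof -
    have "(LINT \<xi>|lborel. complex_of_real (g \<xi>) * cis (\<xi> \<bullet> (snd p - fst p))) = complex_of_real (S * k p)"
      using has_bochner_integral_gaussian_cis_euclidean[OF \<sigma>, of "snd p - fst p"]
      unfolding has_bochner_integral_iff g_def S_def k_def by (simp add: case_prod_beta)
    then show ?thesis
      unfolding H_def by (simp add: mult.left_commute[of "complex_of_real _"] del: of_real_mult)
  qed
  have intgF: "integrable lborel (\<lambda>\<xi>. g \<xi> * (cmod (F \<xi>))\<^sup>2)"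
    using lborel_pair.integrable_fst'[OF intH] unfolding Hg complex_of_real_integrable_eq .
  have kx: "(\<integral>\<^sup>+y. ennreal (k (x, y)) \<partial>lborel) = ennreal ((sqrt (2 * pi) / \<sigma>) ^ DIM('a))" for x
    unfolding k_def using nn_integral_gaussian_euclidean[OF \<sigma>, of x] by simp
  have ky: "(\<integral>\<^sup>+x. ennreal (k (x, y)) \<partial>lborel) = ennreal ((sqrt (2 * pi) / \<sigma>) ^ DIM('a))" for y
    unfolding k_def using nn_integral_gaussian_euclidean[OF \<sigma>, of y] by (simp add: norm_minus_commute)
  have "complex_of_real (LINT \<xi>|lborel. g \<xi> * (cmod (F \<xi>))\<^sup>2) = (LINT \<xi>|lborel. LINT p|lborel. H (\<xi>, p))"
    unfolding Hg by (rule integral_complex_of_real[symmetric])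
  also have "\<dots> = (LINT p|lborel. LINT \<xi>|lborel. H (\<xi>, p))"
    using lborel_pair.Fubini_integral[of "\<lambda>\<xi> p. H (\<xi>, p)"] intH by simp
  also have "\<dots> = (LINT p|lborel. h p * complex_of_real (S * k p))" unfolding Hx ..
  finally have eq: "complex_of_real (LINT \<xi>|lborel. g \<xi> * (cmod (F \<xi>))\<^sup>2) = (LINT p|lborel. h p * complex_of_real (S * k p))" .
  have gFn: "0 \<le> g \<xi> * (cmod (F \<xi>))\<^sup>2" for \<xi> using g0[of \<xi>] by simp
  have "(\<integral>\<^sup>+\<xi>. ennreal (g \<xi> * (cmod (F \<xi>))\<^sup>2) \<partial>lborel) = ennreal (LINT \<xi>|lborel. g \<xi> * (cmod (F \<xi>))\<^sup>2)"
    using gFn by (intro nn_integral_eq_integral intgF) auto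
  also have "\<dots> = ennreal (cmod (LINT p|lborel. h p * complex_of_real (S * k p)))"
    unfolding eq[symmetric] using gFn by (simp add: integral_nonneg)
  also have "\<dots> \<le> (\<integral>\<^sup>+p. ennreal (cmod (h p * complex_of_real (S * k p))) \<partial>lborel)"
  proof (rule integral_norm_bound_ennreal)
    show "integrable lborel (\<lambda>p. h p * complex_of_real (S * k p))"
      using lborel_pair.integrable_snd[of "\<lambda>\<xi> p. H (\<xi>, p)"] intH unfolding Hx by simp
  qed
  \<comment> \<open>The inequality \<open>2 * a * b \<le> a\<^sup>2 + b\<^sup>2\<close> separates
    the two points, so that each term needs only the mass of \<open>k\<close> in the other
    variable.\<close>
  also have "\<dots> \<le> (\<integral>\<^sup>+p. (case p of (x, y) \<Rightarrow> ennreal (S / 2 * (cmod (f x))\<^sup>2) * ennreal (k (x, y)) + ennreal (S / 2 * (cmod (f y))\<^sup>2) * ennreal (k (x, y))) \<partial>lborel)"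
  proof (rule nn_integral_mono)
    fix p :: "'a \<times> 'a"
    obtain x y where p: "p = (x, y)" by force
    have k: "k (x, y) > 0" unfolding k_def by simp
    have "2 * (cmod (f x) * cmod (f y)) \<le> (cmod (f x))\<^sup>2 + (cmod (f y))\<^sup>2"
      using sum_squares_bound[of "cmod (f x)" "cmod (f y)"] by (simp add: mult_ac)
    then have "(S * k (x, y) / 2) * (2 * (cmod (f x) * cmod (f y))) \<le> (S * k (x, y) / 2) * ((cmod (f x))\<^sup>2 + (cmod (f y))\<^sup>2)"
      using S k by (intro mult_left_mono) auto
    then show "ennreal (cmod (h p * complex_of_real (S * k p))) \<le> (case p of (x, y) \<Rightarrow> ennreal (S / 2 * (cmod (f x))\<^sup>2) * ennreal (k (x, y)) + ennreal (S / 2 * (cmod (f y))\<^sup>2) * ennreal (k (x, y)))"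
      using S k unfolding p h_def
      by (auto simp: norm_mult ennreal_mult[symmetric] ennreal_plus[symmetric] algebra_simps simp del: ennreal_plus intro!: ennreal_leI)
  qed
  also have "\<dots> = (\<integral>\<^sup>+p. (case p of (x, y) \<Rightarrow> ennreal (S / 2 * (cmod (f x))\<^sup>2) * ennreal (k (x, y))) \<partial>lborel)
      + (\<integral>\<^sup>+p. (case p of (x, y) \<Rightarrow> ennreal (S / 2 * (cmod (f y))\<^sup>2) * ennreal (k (x, y))) \<partial>lborel)"
    unfolding lborel_prod[symmetric]
    by (subst nn_integral_add[symmetric]) (auto intro!: nn_integral_cong)
  also have "(\<integral>\<^sup>+p. (case p of (x, y) \<Rightarrow> ennreal (S / 2 * (cmod (f x))\<^sup>2) * ennreal (k (x, y))) \<partial>lborel)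
     = (\<integral>\<^sup>+x. ennreal (S / 2 * (cmod (f x))\<^sup>2) * ennreal ((sqrt (2 * pi) / \<sigma>) ^ DIM('a)) \<partial>lborel)"
    unfolding lborel_prod[symmetric]
    by (subst lborel.nn_integral_fst[symmetric]) (auto simp: nn_integral_cmult kx ky intro!: nn_integral_cong)
  also have "(\<integral>\<^sup>+p. (case p of (x, y) \<Rightarrow> ennreal (S / 2 * (cmod (f y))\<^sup>2) * ennreal (k (x, y))) \<partial>lborel)
     = (\<integral>\<^sup>+y. ennreal (S / 2 * (cmod (f y))\<^sup>2) * ennreal ((sqrt (2 * pi) / \<sigma>) ^ DIM('a)) \<partial>lborel)"
    unfolding lborel_prod[symmetric]
    by (subst lborel_pair.nn_integral_snd[symmetric]) (auto simp: nn_integral_cmult kx ky intro!: nn_integral_cong)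
  also have "(\<integral>\<^sup>+x. ennreal (S / 2 * (cmod (f x))\<^sup>2) * ennreal ((sqrt (2 * pi) / \<sigma>) ^ DIM('a)) \<partial>lborel)
     = ennreal (LINT x|lborel. S / 2 * (cmod (f x))\<^sup>2 * ((sqrt (2 * pi) / \<sigma>) ^ DIM('a)))"
    using S \<sigma> f2 by (subst nn_integral_eq_integral[symmetric]) (auto simp: ennreal_mult[symmetric])
  also have "(LINT x|lborel. S / 2 * (cmod (f x))\<^sup>2 * ((sqrt (2 * pi) / \<sigma>) ^ DIM('a)))
     = (S * (sqrt (2 * pi) / \<sigma>) ^ DIM('a)) / 2 * (LINT x|lborel. (cmod (f x))\<^sup>2)"
    by simp
  \<comment> \<open>The powers of \<sigma> cancel, so the bound is uniform in the width and survives
    its removal.\<close>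
  also have "S * (sqrt (2 * pi) / \<sigma>) ^ DIM('a) = (2 * pi) ^ DIM('a)"
    unfolding S_def power_mult_distrib[symmetric] using \<sigma> by (simp add: power_mult_distrib)
  finally show ?thesis
    unfolding F_def g_def by (simp add: ennreal_plus[symmetric] mult_ac del: ennreal_plus)
qed


lemma borel_measurable_fourier_integral:
  fixes f :: "'a::euclidean_space \<Rightarrow> complex"
  assumes [measurable]: "f \<in> borel_measurable borel"
  shows "(\<lambda>\<xi>. LINT x|lborel. f x * cis (- (\<xi> \<bullet> x))) \<in> borel_measurable borel"
proof -
  have [measurable]: "cis \<in> borel_measurable borel"
    unfolding cis_conv_exp by (intro borel_measurable_continuous_onI continuous_intros)
  show ?thesis
    using lborel.borel_measurable_lebesgue_integral[of "\<lambda>\<xi> x. f x * cis (- (\<xi> \<bullet> x))" borel] by measurable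
qed

text \<open>The weights of width \<open>Suc m\<close> tend to 1 pointwise, and Fatou's lemma carries
  the uniform bound to the limit.\<close>

lemma plancherel_le_lborel:
  fixes f :: "'a::euclidean_space \<Rightarrow> complex"
  assumes f: "integrable lborel f" and f2: "integrable lborel (\<lambda>x. (cmod (f x))\<^sup>2)"
  shows "(\<integral>\<^sup>+\<xi>. ennreal ((cmod (LINT x|lborel. f x * cis (- (\<xi> \<bullet> x))))\<^sup>2) \<partial>lborel)
     \<le> ennreal ((2 * pi) ^ DIM('a) * (LINT x|lborel. (cmod (f x))\<^sup>2))"
proof -
  define F where "F \<xi> = (LINT x|lborel. f x * cis (- (\<xi> \<bullet> x)))" for \<xi>
  have [measurable]: "F \<in> borel_measurable borel"
    unfolding F_def by (rule borel_measurable_fourier_integral) (use f in auto)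
  define u where "u m \<xi> = ennreal (exp (- (norm \<xi> / real (Suc m))\<^sup>2 / 2) * (cmod (F \<xi>))\<^sup>2)" for m \<xi>
  have "(\<lambda>m. u m \<xi>) \<longlonglongrightarrow> ennreal ((cmod (F \<xi>))\<^sup>2)" for \<xi>
  proof -
    have "(\<lambda>m. norm \<xi> / real (Suc m)) \<longlonglongrightarrow> 0"
      by (rule LIMSEQ_Suc[OF lim_const_over_n])
    then have "(\<lambda>m. exp (- (norm \<xi> / real (Suc m))\<^sup>2 / 2) * (cmod (F \<xi>))\<^sup>2) \<longlonglongrightarrow> exp (- 0\<^sup>2 / 2) * (cmod (F \<xi>))\<^sup>2"
      by (intro tendsto_intros) auto
    then show ?thesis unfolding u_def by (intro tendsto_ennrealI) simp
  qed
  then have lim: "liminf (\<lambda>m. u m \<xi>) = ennreal ((cmod (F \<xi>))\<^sup>2)" for \<xi>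
    by (intro lim_imp_Liminf) auto
  have "(\<integral>\<^sup>+\<xi>. ennreal ((cmod (F \<xi>))\<^sup>2) \<partial>lborel) = (\<integral>\<^sup>+\<xi>. liminf (\<lambda>m. u m \<xi>) \<partial>lborel)"
    unfolding lim ..
  also have "\<dots> \<le> liminf (\<lambda>m. \<integral>\<^sup>+\<xi>. u m \<xi> \<partial>lborel)"
    by (rule nn_integral_liminf) (simp add: u_def)
  also have "\<dots> \<le> liminf (\<lambda>m::nat. ennreal ((2 * pi) ^ DIM('a) * (LINT x|lborel. (cmod (f x))\<^sup>2)))"
    unfolding u_def F_def by (intro Liminf_mono always_eventually allI plancherel_le_gaussian f f2) simp
  also have "\<dots> = ennreal ((2 * pi) ^ DIM('a) * (LINT x|lborel. (cmod (f x))\<^sup>2))"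
    by (simp add: Liminf_const)
  finally show ?thesis unfolding F_def .
qed

text \<open>The Fubini arguments take place on \<open>lborel\<close>, while the hypotheses on
  \<open>f\<close> concern its completion; an almost everywhere equal Borel function links the
  two.\<close>

lemma borel_representative:
  fixes f :: "'a::euclidean_space \<Rightarrow> complex"
  assumes "f \<in> borel_measurable lebesgue"
  obtains g where "g \<in> borel_measurable borel" "AE x in lborel. f x = g x"
proof -
  have "(\<lambda>x. Re (f x)) \<in> borel_measurable (completion lborel)" "(\<lambda>x. Im (f x)) \<in> borel_measurable (completion lborel)"
    using assms by auto
  from this[THEN completion_ex_borel_measurable_real] obtain a b
    where ab: "a \<in> borel_measurable borel" "b \<in> borel_measurable borel"
      "AE x in lborel. Re (f x) = a x" "AE x in lborel. Im (f x) = b x" by auto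
  show thesis
  proof (rule that[of "\<lambda>x. complex_of_real (a x) + \<i> * complex_of_real (b x)"])
    show "AE x in lborel. f x = complex_of_real (a x) + \<i> * complex_of_real (b x)"
      using ab(3,4) by eventually_elim (auto simp: complex_eq_iff)
  qed (use ab in auto)
qed

lemma
  fixes f :: "'a::euclidean_space \<Rightarrow> complex"
  assumes f: "integrable lebesgue f"
  shows borel_measurable_fourier_lebesgue:
      "(\<lambda>\<xi>. LINT x|lebesgue. f x * cis (- (\<xi> \<bullet> x))) \<in> borel_measurable borel"
    and plancherel_le: "integrable lebesgue (\<lambda>x. (cmod (f x))\<^sup>2) \<Longrightarrow>
      (\<integral>\<^sup>+\<xi>. ennreal ((cmod (LINT x|lebesgue. f x * cis (- (\<xi> \<bullet> x))))\<^sup>2) \<partial>lebesgue)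
       \<le> ennreal ((2 * pi) ^ DIM('a) * (LINT x|lebesgue. (cmod (f x))\<^sup>2))"
proof -
  have fm: "f \<in> borel_measurable lebesgue" using f by auto
  then obtain g where g[measurable]: "g \<in> borel_measurable borel" and fg: "AE x in lborel. f x = g x"
    using borel_representative by blast
  have fg': "AE x in lebesgue. f x = g x" using fg by (rule AE_completion)
  have gm: "g \<in> borel_measurable lebesgue" using g by (intro measurable_completion) simp
  have cism[measurable]: "(\<lambda>x. cis (- (\<xi> \<bullet> x))) \<in> borel_measurable borel" for \<xi> :: 'a
    unfolding cis_conv_exp by (intro borel_measurable_continuous_onI continuous_intros)
  have cism': "(\<lambda>x. cis (- (\<xi> \<bullet> x))) \<in> borel_measurable lebesgue" for \<xi> :: 'a
    using cism by (intro measurable_completion) simp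
  \<comment> \<open>Changing \<open>f\<close> on a null set leaves the transform unchanged at every
    frequency, not only at almost every one.\<close>
  have F: "(LINT x|lebesgue. f x * cis (- (\<xi> \<bullet> x))) = (LINT x|lborel. g x * cis (- (\<xi> \<bullet> x)))" for \<xi>
  proof -
    have "(LINT x|lebesgue. f x * cis (- (\<xi> \<bullet> x))) = (LINT x|lebesgue. g x * cis (- (\<xi> \<bullet> x)))"
      using fg' by (intro integral_cong_AE borel_measurable_times fm gm cism') auto
    also have "\<dots> = (LINT x|lborel. g x * cis (- (\<xi> \<bullet> x)))"
      by (rule integral_completion) simp
    finally show ?thesis .
  qed
  show "(\<lambda>\<xi>. LINT x|lebesgue. f x * cis (- (\<xi> \<bullet> x))) \<in> borel_measurable borel"
    unfolding F by (rule borel_measurable_fourier_integral[OF g])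
  assume f2: "integrable lebesgue (\<lambda>x. (cmod (f x))\<^sup>2)"
  have "integrable lebesgue g" using f fg' fm gm by (subst integrable_cong_AE[symmetric]) auto
  then have gi: "integrable lborel g" by (subst (asm) integrable_completion) auto
  have "integrable lebesgue (\<lambda>x. (cmod (g x))\<^sup>2)"
    using f2 fg' fm gm by (subst integrable_cong_AE[of _ _ "\<lambda>x. (cmod (f x))\<^sup>2"]) auto
  then have gi2: "integrable lborel (\<lambda>x. (cmod (g x))\<^sup>2)" by (subst (asm) integrable_completion) auto
  have "(LINT x|lebesgue. (cmod (f x))\<^sup>2) = (LINT x|lebesgue. (cmod (g x))\<^sup>2)"
    using fg' fm gm by (intro integral_cong_AE) auto
  also have "\<dots> = (LINT x|lborel. (cmod (g x))\<^sup>2)" by (rule integral_completion) simp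
  finally have L2: "(LINT x|lebesgue. (cmod (f x))\<^sup>2) = (LINT x|lborel. (cmod (g x))\<^sup>2)" .
  show "(\<integral>\<^sup>+\<xi>. ennreal ((cmod (LINT x|lebesgue. f x * cis (- (\<xi> \<bullet> x))))\<^sup>2) \<partial>lebesgue)
       \<le> ennreal ((2 * pi) ^ DIM('a) * (LINT x|lebesgue. (cmod (f x))\<^sup>2))"
    unfolding F L2 nn_integral_completion by (rule plancherel_le_lborel[OF gi gi2])
qed

section \<open>Extrapolation of the Fourier transform\<close>

lemma sum_exp_series_le:
  fixes x :: real
  assumes "x \<ge> 0" "finite S"
  shows "(\<Sum>j\<in>S. x ^ j / fact j) \<le> exp x"
proof -
  have "(\<Sum>j\<in>S. x ^ j /\<^sub>R fact j) \<le> (\<Sum>j. x ^ j /\<^sub>R fact j)"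
    using assms by (intro sum_le_suminf summable_exp_generic) auto
  then show ?thesis by (simp add: exp_def divide_inverse mult.commute)
qed

lemma binomial_le_power_div_fact: "real (N choose j) \<le> real N ^ j / fact j"
proof -
  have "real ((N choose j) * fact j) \<le> real (N ^ j)"
    using binomial_fact_pow by (intro of_nat_mono)
  then show ?thesis by (simp add: field_simps)
qed

text \<open>The terms dropped have \<open>j > n\<close>, so each may be multiplied by
  \<open>exp (j - n) \<ge> 1\<close>. This extracts \<open>exp (- n)\<close> and leaves part of the
  exponential series at \<open>exp 1 * b\<close>.\<close>

lemma norm_newton_remainder_le:
  fixes z :: complex
  assumes "real N * cmod (z - 1) \<le> b" "n \<le> N"
  shows "cmod (z ^ N - (\<Sum>j\<le>n. of_nat (N choose j) * (z - 1) ^ j)) \<le> exp (exp 1 * b - real n)"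
proof -
  have b: "b \<ge> 0" by (rule order_trans[OF _ assms(1)]) simp
  have "z ^ N = (\<Sum>j\<le>N. of_nat (N choose j) * (z - 1) ^ j)"
    using binomial_ring[of "z - 1" 1 N] by simp
  also have "{..N} = {..n} \<union> {n<..N}" using assms by auto
  also have "(\<Sum>j\<in>{..n} \<union> {n<..N}. of_nat (N choose j) * (z - 1) ^ j) =
      (\<Sum>j\<le>n. of_nat (N choose j) * (z - 1) ^ j) + (\<Sum>j\<in>{n<..N}. of_nat (N choose j) * (z - 1) ^ j)"
    by (rule sum.union_disjoint) auto
  finally have "cmod (z ^ N - (\<Sum>j\<le>n. of_nat (N choose j) * (z - 1) ^ j))
      = cmod (\<Sum>j\<in>{n<..N}. of_nat (N choose j) * (z - 1) ^ j)" by simp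
  also have "\<dots> \<le> (\<Sum>j\<in>{n<..N}. exp (- real n) * ((exp 1 * b) ^ j / fact j))"
  proof (rule sum_norm_le)
    fix j assume j: "j \<in> {n<..N}"
    have "cmod (of_nat (N choose j) * (z - 1) ^ j) = real (N choose j) * cmod (z - 1) ^ j"
      by (simp add: norm_mult norm_power)
    also have "\<dots> \<le> real N ^ j / fact j * cmod (z - 1) ^ j"
      by (intro mult_right_mono binomial_le_power_div_fact) auto
    also have "\<dots> = (real N * cmod (z - 1)) ^ j / fact j" by (simp add: power_mult_distrib)
    also have "\<dots> \<le> b ^ j / fact j"
      using assms by (intro divide_right_mono power_mono) auto
    also have "\<dots> \<le> exp (real j - real n) * (b ^ j / fact j)"
      using j b mult_right_mono[of 1 "exp (real j - real n)" "b ^ j / fact j"] by simp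
    also have "exp (real j - real n) * (b ^ j / fact j) = exp (- real n) * ((exp 1 * b) ^ j / fact j)"
      by (simp add: exp_diff exp_minus power_mult_distrib exp_of_nat_mult[symmetric] field_simps)
    finally show "cmod (of_nat (N choose j) * (z - 1) ^ j) \<le> exp (- real n) * ((exp 1 * b) ^ j / fact j)" .
  qed
  also have "\<dots> = exp (- real n) * (\<Sum>j\<in>{n<..N}. (exp 1 * b) ^ j / fact j)"
    by (simp add: sum_distrib_left)
  also have "\<dots> \<le> exp (- real n) * exp (exp 1 * b)"
    using b by (intro mult_left_mono sum_exp_series_le) auto
  also have "\<dots> = exp (exp 1 * b - real n)" by (simp add: exp_diff exp_minus field_simps)
  finally show ?thesis .
qed

text \<open>The factor by which extrapolation amplifies the data error. As
  \<open>N / n \<ge> 1\<close>, its powers are at most the \<open>n\<close>-th one, and what remains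
  is part of the exponential series at \<open>2 * n\<close>.\<close>

lemma sum_binomial_pow2_le:
  assumes "1 \<le> n" "n \<le> N"
  shows "(\<Sum>j\<le>n. real (N choose j) * 2 ^ j) \<le> (real N / real n) ^ n * exp (2 * real n)"
proof -
  have "(\<Sum>j\<le>n. real (N choose j) * 2 ^ j) \<le> (\<Sum>j\<le>n. (real N / real n) ^ n * ((2 * real n) ^ j / fact j))"
  proof (rule sum_mono)
    fix j assume j: "j \<in> {..n}"
    have "real (N choose j) * 2 ^ j \<le> real N ^ j / fact j * 2 ^ j"
      by (intro mult_right_mono binomial_le_power_div_fact) auto
    also have "\<dots> = (real N / real n) ^ j * ((2 * real n) ^ j / fact j)"
      using assms by (simp add: power_mult_distrib power_divide)
    also have "\<dots> \<le> (real N / real n) ^ n * ((2 * real n) ^ j / fact j)"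
      using assms j by (intro mult_right_mono power_increasing) auto
    finally show "real (N choose j) * 2 ^ j \<le> (real N / real n) ^ n * ((2 * real n) ^ j / fact j)" .
  qed
  also have "\<dots> = (real N / real n) ^ n * (\<Sum>j\<le>n. (2 * real n) ^ j / fact j)"
    by (simp add: sum_distrib_left)
  also have "\<dots> \<le> (real N / real n) ^ n * exp (2 * real n)"
    by (intro mult_left_mono sum_exp_series_le) auto
  finally show ?thesis .
qed

lemma cmod_cis_minus_1_le: "cmod (cis t - 1) \<le> \<bar>t\<bar>"
  using dist_exp_i_1[of t] abs_sin_x_le_abs_x[of "t / 2"] by (simp add: cis_conv_exp)

text \<open>Multiplying \<open>f\<close> by the \<open>i\<close>-th power of the character
  \<open>z\<close> moves the frequency \<open>p\<close> to the node \<open>p + (i / N) v\<close>,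
  and \<open>i = N\<close> reaches \<open>p + v\<close>. The truncated expansion of
  \<open>z ^ N\<close> uses only nodes with \<open>i \<le> n\<close>, where the transform is small;
  on the support, Cauchy-Schwarz bounds \<open>N * cmod (z x - 1)\<close> by
  \<open>R * norm v\<close>.\<close>

lemma fourier_extrapolation:
  fixes f :: "'a::euclidean_space \<Rightarrow> complex"
  assumes f: "integrable lebesgue f"
    and supp: "\<And>x. f x \<noteq> 0 \<Longrightarrow> norm x \<le> R"
    and N: "1 \<le> N" "n \<le> N"
    and small: "\<And>i. i \<le> n \<Longrightarrow> cmod (LINT x|lebesgue. f x * cis (- ((p + (real i / real N) *\<^sub>R v) \<bullet> x))) \<le> \<epsilon>"
  shows "cmod (LINT x|lebesgue. f x * cis (- ((p + v) \<bullet> x)))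
     \<le> \<epsilon> * (\<Sum>j\<le>n. real (N choose j) * 2 ^ j) + exp (exp 1 * (R * norm v) - real n) * (LINT x|lebesgue. cmod (f x))"
proof -
  define F where "F \<xi> = (LINT x|lebesgue. f x * cis (- (\<xi> \<bullet> x)))" for \<xi>
  define z where "z x = cis (- (v \<bullet> x) / real N)" for x
  define q where "q i = p + (real i / real N) *\<^sub>R v" for i
  have [measurable]: "f \<in> borel_measurable lebesgue" using f by auto
  have fint: "integrable lebesgue (\<lambda>x. f x * cis (- (\<xi> \<bullet> x)))" for \<xi>
  proof (rule Bochner_Integration.integrable_bound[OF f])
    have "(\<lambda>x. cis (- (\<xi> \<bullet> x))) \<in> borel_measurable borel"
      unfolding cis_conv_exp by (intro borel_measurable_continuous_onI continuous_intros)
    then have "(\<lambda>x. cis (- (\<xi> \<bullet> x))) \<in> borel_measurable lebesgue"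
      by (intro measurable_completion) simp
    then show "(\<lambda>x. f x * cis (- (\<xi> \<bullet> x))) \<in> borel_measurable lebesgue" by simp
  qed (auto simp: norm_mult)
  have zi: "cis (- (p \<bullet> x)) * z x ^ i = cis (- (q i \<bullet> x))" for x i
    unfolding z_def q_def Complex.DeMoivre cis_mult by (simp add: inner_add_left field_simps)
  have qN: "q N = p + v" unfolding q_def using N by simp
  define P where "P w = (\<Sum>j\<le>n. of_nat (N choose j) * (w - 1) ^ j)" for w :: complex
  \<comment> \<open>Expanding \<open>(w - 1) ^ j\<close> once more exposes the powers of
    \<open>w\<close>, that is, the nodes. The moduli of the new coefficients add up to
    \<open>2 ^ j\<close> for each \<open>j\<close>.\<close>
  have Peq: "P w = (\<Sum>j\<le>n. \<Sum>i\<le>j. (of_nat (N choose j) * of_nat (j choose i) * (- 1) ^ (j - i)) * w ^ i)" for w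
    unfolding P_def using binomial_ring[of w "- 1"]
    by (simp add: sum_distrib_left mult_ac)
  define G where "G x = (f x * cis (- (p \<bullet> x))) * P (z x)" for x
  have Geq: "G x = (\<Sum>j\<le>n. \<Sum>i\<le>j. (of_nat (N choose j) * of_nat (j choose i) * (- 1) ^ (j - i)) * (f x * cis (- (q i \<bullet> x))))" for x
    unfolding G_def Peq zi[symmetric] sum_distrib_left by (intro sum.cong refl) (simp add: mult_ac)
  have Gint: "integrable lebesgue G"
    unfolding Geq using fint by (intro Bochner_Integration.integrable_sum integrable_mult_right) auto
  have "(LINT x|lebesgue. G x) = (\<Sum>j\<le>n. \<Sum>i\<le>j. (of_nat (N choose j) * of_nat (j choose i) * (- 1) ^ (j - i)) * F (q i))"
    unfolding Geq F_def using fint by (simp add: Bochner_Integration.integral_sum)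
  also have "cmod \<dots> \<le> (\<Sum>j\<le>n. \<Sum>i\<le>j. real (N choose j) * real (j choose i) * \<epsilon>)"
    using small by (intro sum_norm_le) (auto simp: norm_mult norm_power F_def q_def intro!: mult_left_mono)
  also have "\<dots> = \<epsilon> * (\<Sum>j\<le>n. real (N choose j) * real (\<Sum>i\<le>j. j choose i))"
    by (simp add: sum_distrib_left mult_ac)
  also have "\<dots> = \<epsilon> * (\<Sum>j\<le>n. real (N choose j) * 2 ^ j)"
    unfolding choose_row_sum by simp
  finally have 1: "cmod (LINT x|lebesgue. G x) \<le> \<epsilon> * (\<Sum>j\<le>n. real (N choose j) * 2 ^ j)" .
  define E where "E = exp (exp 1 * (R * norm v) - real n)"
  have "F (p + v) - (LINT x|lebesgue. G x) = (LINT x|lebesgue. f x * cis (- ((p + v) \<bullet> x)) - G x)"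
    unfolding F_def using fint Gint by simp
  also have "cmod \<dots> \<le> (LINT x|lebesgue. E * cmod (f x))"
  proof (rule Bochner_Integration.integral_norm_bound_integral)
    show "cmod (f x * cis (- ((p + v) \<bullet> x)) - G x) \<le> E * cmod (f x)" for x
    proof (cases "f x = 0")
      case False
      have "f x * cis (- ((p + v) \<bullet> x)) - G x = (f x * cis (- (p \<bullet> x))) * (z x ^ N - P (z x))"
        unfolding G_def right_diff_distrib using zi[of x N] unfolding qN by (simp add: mult_ac)
      then have "cmod (f x * cis (- ((p + v) \<bullet> x)) - G x) = cmod (f x) * cmod (z x ^ N - P (z x))"
        by (simp add: norm_mult)
      also have "\<dots> \<le> cmod (f x) * E"
        unfolding E_def P_def
      proof (intro mult_left_mono norm_newton_remainder_le N)
        have "real N * cmod (z x - 1) \<le> real N * \<bar>- (v \<bullet> x) / real N\<bar>"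
          unfolding z_def by (intro mult_left_mono cmod_cis_minus_1_le) auto
        also have "\<dots> = \<bar>v \<bullet> x\<bar>" using N by simp
        also have "\<dots> \<le> norm v * norm x" by (rule Cauchy_Schwarz_ineq2)
        also have "\<dots> \<le> norm v * R" using supp[OF False] by (intro mult_left_mono) auto
        finally show "real N * cmod (z x - 1) \<le> R * norm v" by (simp add: mult_ac)
      qed simp
      finally show ?thesis by (simp add: mult_ac)
    qed (simp add: G_def)
  qed (use f fint Gint in auto)
  finally have 2: "cmod (F (p + v) - (LINT x|lebesgue. G x)) \<le> E * (LINT x|lebesgue. cmod (f x))" by simp
  have "cmod (F (p + v)) \<le> cmod (LINT x|lebesgue. G x) + cmod (F (p + v) - (LINT x|lebesgue. G x))"
    by (rule norm_triangle_sub)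
  with 1 2 show ?thesis unfolding F_def E_def by simp
qed

section \<open>From the far-field data to the Fourier transform\<close>

lemma far_field_eq: "far_field f xh k = (LINT x|lebesgue. f x * cis (- ((k *\<^sub>R xh) \<bullet> x)))"
  unfolding far_field_def by (simp add: mult_ac)

lemma cmod_fourier_le_L1:
  fixes f :: "'a::euclidean_space \<Rightarrow> complex"
  shows "cmod (LINT x|lebesgue. f x * cis (- (\<xi> \<bullet> x))) \<le> (LINT x|lebesgue. cmod (f x))"
  using integral_norm_bound[of lebesgue "\<lambda>x. f x * cis (- (\<xi> \<bullet> x))"] by (simp add: norm_mult)

text \<open>A real supremum dominates its members only if the family is bounded above; the L1 norm
  of \<open>f\<close> is such a bound for all directions and wavenumbers.\<close>

lemma far_field_le_eps_data:
  assumes "xh \<in> Vdelta \<delta> x0" "0 < k" "k < K"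
  shows "cmod (far_field f xh k) \<le> eps_data f \<delta> x0 K"
proof -
  have "bdd_above ((\<lambda>p. cmod (far_field f (fst p) (snd p))) ` (Vdelta \<delta> x0 \<times> {0<..<K}))"
    unfolding far_field_eq using cmod_fourier_le_L1 by (intro bdd_aboveI2)
  from cSUP_upper[OF _ this, of "(xh, k)"] show ?thesis
    using assms unfolding eps_data_def by simp
qed

text \<open>The norm of \<open>y\<close> differs from \<open>T / 2\<close> by at most
  \<open>c * T\<close>, so it lies between \<open>T / 4\<close> and \<open>3 * T / 4 < K\<close>.
  Hence \<open>y\<close> is within \<open>2 * c * T\<close> of \<open>norm y *\<^sub>R x0\<close>,
  and division by \<open>norm y\<close> puts its direction within
  \<open>8 * c \<le> \<delta> / 2\<close> of \<open>x0\<close>.\<close>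

lemma ball_subset_cone:
  assumes x0: "x0 \<in> sphere2" and T: "0 < T" "T \<le> K" and c: "c \<le> 1/4" "16 * c \<le> \<delta>" "0 < c"
    and y: "norm (y - (T / 2) *\<^sub>R x0) \<le> c * T"
  obtains k xh where "y = k *\<^sub>R xh" "xh \<in> Vdelta \<delta> x0" "0 < k" "k < K"
proof -
  have nx0: "norm x0 = 1" using x0 unfolding sphere2_def by simp
  have np: "norm ((T / 2) *\<^sub>R x0) = T / 2" using T nx0 by simp
  have cT: "c * T \<le> T / 4" using c T by simp
  have diff: "\<bar>norm y - T / 2\<bar> \<le> c * T"
    using norm_triangle_ineq3[of y "(T / 2) *\<^sub>R x0"] y unfolding np by linarith
  have ny: "T / 4 \<le> norm y" "norm y < K" using diff cT T by linarith+
  have y0: "norm y > 0" using ny T by linarith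
  have "norm (y - norm y *\<^sub>R x0) \<le> norm (y - (T / 2) *\<^sub>R x0) + norm ((T / 2) *\<^sub>R x0 - norm y *\<^sub>R x0)"
    using norm_triangle_ineq[of "y - (T / 2) *\<^sub>R x0" "(T / 2) *\<^sub>R x0 - norm y *\<^sub>R x0"] by simp
  also have "norm ((T / 2) *\<^sub>R x0 - norm y *\<^sub>R x0) = \<bar>T / 2 - norm y\<bar>"
    unfolding scaleR_left_diff_distrib[symmetric] using nx0 by simp
  finally have 1: "norm (y - norm y *\<^sub>R x0) \<le> 2 * (c * T)" using y diff by linarith
  have "2 * (c * T) \<le> \<delta> * (T / 8)" using mult_right_mono[OF c(2), of "T / 8"] T by simp
  also have "\<dots> < \<delta> * norm y" using ny T c by (intro mult_strict_left_mono) auto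
  finally have 2: "norm (y - norm y *\<^sub>R x0) < \<delta> * norm y" using 1 by linarith
  have "y /\<^sub>R norm y - x0 = (y - norm y *\<^sub>R x0) /\<^sub>R norm y"
    using y0 by (simp add: scaleR_right_diff_distrib)
  then have "norm (y /\<^sub>R norm y - x0) = norm (y - norm y *\<^sub>R x0) / norm y"
    by (simp add: divide_inverse mult.commute)
  also have "\<dots> < \<delta>" using 2 y0 by (simp add: pos_divide_less_eq)
  finally have "y /\<^sub>R norm y \<in> Vdelta \<delta> x0"
    unfolding Vdelta_def sphere2_def using y0 by simp
  then show thesis using ny y0 by (intro that[of "norm y" "y /\<^sub>R norm y"]) auto
qed

text \<open>Cauchy-Schwarz against the indicator of the ball. Working with nonnegative integrals
  makes the one bound yield integrability as well as the norm estimate.\<close>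

lemma
  fixes f :: "'a::euclidean_space \<Rightarrow> complex"
  assumes f: "f \<in> borel_measurable lebesgue" and f2: "integrable lebesgue (\<lambda>x. (cmod (f x))\<^sup>2)"
    and supp: "\<And>x. f x \<noteq> 0 \<Longrightarrow> norm x \<le> R"
  shows integrable_of_square_integrable: "integrable lebesgue f"
    and L1_norm_le_L2_norm: "(LINT x|lebesgue. cmod (f x))\<^sup>2 \<le> measure lebesgue (cball 0 R :: 'a set) * (LINT x|lebesgue. (cmod (f x))\<^sup>2)"
proof -
  note [measurable] = f
  have [measurable]: "cball 0 R \<in> sets (lebesgue :: 'a measure)" by simp
  have fin: "emeasure lebesgue (cball 0 R :: 'a set) = ennreal (measure lebesgue (cball 0 R :: 'a set))"
    by (intro emeasure_eq_ennreal_measure) (use emeasure_bounded_finite[of "cball 0 R :: 'a set"] in auto)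
  have "(\<integral>\<^sup>+x. ennreal (cmod (f x)) \<partial>lebesgue)\<^sup>2 = (\<integral>\<^sup>+x. ennreal (cmod (f x)) * indicator (cball 0 R) x \<partial>lebesgue)\<^sup>2"
    using supp by (intro arg_cong[where f="\<lambda>x. x\<^sup>2"] nn_integral_cong) (auto simp: indicator_def)
  also have "\<dots> \<le> (\<integral>\<^sup>+x. (ennreal (cmod (f x)))\<^sup>2 \<partial>lebesgue) * (\<integral>\<^sup>+x. (indicator (cball 0 R) x)\<^sup>2 \<partial>(lebesgue :: 'a measure))"
    by (rule Cauchy_Schwarz_nn_integral) auto
  also have "(\<integral>\<^sup>+x. (indicator (cball 0 R) x)\<^sup>2 \<partial>(lebesgue :: 'a measure)) = (\<integral>\<^sup>+x. indicator (cball 0 R) x \<partial>(lebesgue :: 'a measure))"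
    by (intro nn_integral_cong) (auto simp: indicator_def)
  also have "\<dots> = ennreal (measure lebesgue (cball 0 R :: 'a set))" using fin by simp
  also have "(\<integral>\<^sup>+x. (ennreal (cmod (f x)))\<^sup>2 \<partial>lebesgue) = ennreal (LINT x|lebesgue. (cmod (f x))\<^sup>2)"
    using f2 by (subst nn_integral_eq_integral[symmetric]) (auto simp: ennreal_power)
  also have "\<dots> * ennreal (measure lebesgue (cball 0 R :: 'a set)) = ennreal (measure lebesgue (cball 0 R :: 'a set) * (LINT x|lebesgue. (cmod (f x))\<^sup>2))"
    by (subst ennreal_mult[symmetric]) (auto simp: mult.commute)
  finally have CS: "(\<integral>\<^sup>+x. ennreal (cmod (f x)) \<partial>lebesgue)\<^sup>2 \<le> ennreal (measure lebesgue (cball 0 R :: 'a set) * (LINT x|lebesgue. (cmod (f x))\<^sup>2))" .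
  then have "(\<integral>\<^sup>+x. ennreal (cmod (f x)) \<partial>lebesgue)\<^sup>2 < top"
    by (rule order_le_less_trans) simp
  then have "(\<integral>\<^sup>+x. ennreal (cmod (f x)) \<partial>lebesgue) < \<infinity>"
    by (simp add: power2_eq_square ennreal_mult_less_top) (auto simp: less_top)
  then show int: "integrable lebesgue f"
    by (intro integrableI_bounded) auto
  have "(\<integral>\<^sup>+x. ennreal (cmod (f x)) \<partial>lebesgue) = ennreal (LINT x|lebesgue. cmod (f x))"
    using int by (intro nn_integral_eq_integral) auto
  with CS show "(LINT x|lebesgue. cmod (f x))\<^sup>2 \<le> measure lebesgue (cball 0 R :: 'a set) * (LINT x|lebesgue. (cmod (f x))\<^sup>2)"
    by (simp add: ennreal_power)
qed

text \<open>The first factor bounds \<open>n / A\<close> for the truncation degree \<open>n\<close>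
  chosen below. The minimum is the relative radius \<open>c\<close> of the ball of nodes, and
  \<open>4 / c + 2\<close> comes from the ratio \<open>N / n\<close> and from
  \<open>exp (2 * n)\<close>.\<close>

definition growth_const :: "real \<Rightarrow> real \<Rightarrow> real" where
  "growth_const R \<delta> = (2 * exp 1 * R + 2) * (4 / min (1/4) (\<delta> / 16) + 2)"

lemma fourier_le_eps_data:
  fixes f :: "real^3 \<Rightarrow> complex"
  assumes R: "R \<ge> 1" and \<delta>: "\<delta> > 0" and x0: "x0 \<in> sphere2" and K: "K > 1" and A: "A \<ge> 1"
    and f: "integrable lebesgue f" and supp: "\<And>x. f x \<noteq> 0 \<Longrightarrow> norm x \<le> R" and \<xi>: "norm \<xi> \<le> A"
  shows "cmod (LINT x|lebesgue. f x * cis (- (\<xi> \<bullet> x)))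
     \<le> eps_data f \<delta> x0 K * exp (growth_const R \<delta> * (A + A\<^sup>2 / K)) + exp (- A) * (LINT x|lebesgue. cmod (f x))"
proof -
  define c where "c = min (1/4) (\<delta> / 16)"
  have c: "c \<le> 1/4" "16 * c \<le> \<delta>" "0 < c" unfolding c_def using \<delta> by auto
  define T where "T = min A K"
  have T: "0 < T" "T \<le> K" "T \<le> A" unfolding T_def using A K by auto
  \<comment> \<open>The segment from \<open>p\<close> to \<xi> has length at most
    \<open>2 * A\<close>, so its initial fraction \<open>l\<close> stays in the ball of radius
    \<open>c * T\<close>.\<close>
  define l where "l = c * T / (2 * A)"
  have l: "0 < l" "l \<le> 1"
  proof -
    show "0 < l" unfolding l_def using c T A by simp
    have "c * T \<le> 1 * A" using c T by (intro mult_mono) auto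
    then show "l \<le> 1" unfolding l_def using A by (simp add: pos_divide_le_eq)
  qed
  have up: "real (nat \<lceil>x\<rceil>) \<le> x + 1" if "0 \<le> x" for x :: real
    using that of_int_ceiling_le_add_one[of x] by simp
  \<comment> \<open>The Newton remainder has exponent
    \<open>exp 1 * R * norm (\<xi> - p) - n\<close>, where the first term is at most
    \<open>exp 1 * (2 * R * A)\<close>; the additional \<open>A\<close> leaves an error of
    \<open>exp (- A)\<close>.\<close>
  define n where "n = nat \<lceil>exp 1 * (2 * R * A) + A\<rceil>"
  \<comment> \<open>With \<open>n / N \<le> l\<close>, all nodes up to index \<open>n\<close> remain
    in the ball covered by the data.\<close>
  define N where "N = nat \<lceil>real n / l\<rceil>"
  have eRA: "0 \<le> exp 1 * (2 * R * A)" using R A by simp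
  have n: "exp 1 * (2 * R * A) + A \<le> real n" "real n \<le> exp 1 * (2 * R * A) + A + 1"
    unfolding n_def using eRA A by (auto intro!: real_nat_ceiling_ge up)
  have n1: "1 \<le> n" using n(1) eRA A by linarith
  have N: "real n / l \<le> real N" "real N \<le> real n / l + 1"
    unfolding N_def using l by (auto intro!: real_nat_ceiling_ge up)
  have nl: "real n \<le> real n / l" using l by (simp add: le_divide_eq mult_left_le)
  have nN: "n \<le> N" using N nl by linarith
  have N1: "1 \<le> N" using nN n1 by simp
  define p where "p = (T / 2) *\<^sub>R x0"
  have np: "norm p = T / 2" using x0 T unfolding p_def sphere2_def by simp
  have nv: "norm (\<xi> - p) \<le> 2 * A" using norm_triangle_ineq4[of \<xi> p] \<xi> np T by linarith
  have "cmod (LINT x|lebesgue. f x * cis (- ((p + (\<xi> - p)) \<bullet> x)))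
     \<le> eps_data f \<delta> x0 K * (\<Sum>j\<le>n. real (N choose j) * 2 ^ j) + exp (exp 1 * (R * norm (\<xi> - p)) - real n) * (LINT x|lebesgue. cmod (f x))"
  proof (rule fourier_extrapolation[OF f supp N1 nN])
    fix i assume i: "i \<le> n"
    have "norm ((p + (real i / real N) *\<^sub>R (\<xi> - p)) - p) = real i / real N * norm (\<xi> - p)" by simp
    also have "\<dots> \<le> l * (2 * A)"
    proof (intro mult_mono nv)
      have "real i \<le> l * real N" using i N(1) l by (simp add: divide_le_eq mult.commute)
      then show "real i / real N \<le> l" using N1 by (simp add: divide_le_eq)
    qed (use l in auto)
    also have "\<dots> = c * T" unfolding l_def using A by simp
    finally have "norm ((p + (real i / real N) *\<^sub>R (\<xi> - p)) - (T / 2) *\<^sub>R x0) \<le> c * T" unfolding p_def .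
    from ball_subset_cone[OF x0 T(1,2) c this] obtain k xh
      where "p + (real i / real N) *\<^sub>R (\<xi> - p) = k *\<^sub>R xh" "xh \<in> Vdelta \<delta> x0" "0 < k" "k < K" .
    then show "cmod (LINT x|lebesgue. f x * cis (- ((p + (real i / real N) *\<^sub>R (\<xi> - p)) \<bullet> x))) \<le> eps_data f \<delta> x0 K"
      using far_field_le_eps_data[of xh \<delta> x0 k K f] unfolding far_field_eq by simp
  qed
  also have "p + (\<xi> - p) = \<xi>" by simp
  finally have main: "cmod (LINT x|lebesgue. f x * cis (- (\<xi> \<bullet> x)))
     \<le> eps_data f \<delta> x0 K * (\<Sum>j\<le>n. real (N choose j) * 2 ^ j) + exp (exp 1 * (R * norm (\<xi> - p)) - real n) * (LINT x|lebesgue. cmod (f x))" .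
  have eps0: "0 \<le> eps_data f \<delta> x0 K"
  proof (rule order_trans[OF norm_ge_zero far_field_le_eps_data])
    show "x0 \<in> Vdelta \<delta> x0" unfolding Vdelta_def using x0 \<delta> by simp
    show "(0::real) < 1 / 2" "1 / 2 < K" using K by auto
  qed
  have "exp (exp 1 * (R * norm (\<xi> - p)) - real n) \<le> exp (- A)"
  proof -
    have "exp 1 * (R * norm (\<xi> - p)) \<le> exp 1 * (R * (2 * A))"
      using nv R by (intro mult_left_mono) auto
    then show ?thesis using n(1) by (simp add: mult_ac)
  qed
  moreover have "(\<Sum>j\<le>n. real (N choose j) * 2 ^ j) \<le> exp (growth_const R \<delta> * (A + A\<^sup>2 / K))"
  proof -
    \<comment> \<open>The ratio is 1 when \<open>A \<le> K\<close> and \<open>A / K\<close>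
      otherwise. Its exponential bound, raised to a power of order \<open>A\<close>, produces the
      term \<open>A\<^sup>2 / K\<close> in the exponent.\<close>
    have AT: "A / T \<le> exp (A / K)"
    proof (cases "A \<le> K")
      case True
      then have "A / T = 1" unfolding T_def using A by simp
      then show ?thesis using A K by simp
    next
      case False
      then have "A / T = A / K" unfolding T_def by simp
      then show ?thesis using exp_ge_add_one_self[of "A / K"] by linarith
    qed
    \<comment> \<open>Rounding up costs at most a factor 2, since
      \<open>n / l \<ge> n \<ge> 1\<close>.\<close>
    have "real N / real n \<le> (2 * (real n / l)) / real n"
      using N(2) nl n1 by (intro divide_right_mono) auto
    also have "\<dots> = (4 / c) * (A / T)" unfolding l_def using n1 by simp
    also have "\<dots> \<le> exp (4 / c) * exp (A / K)"
      using AT c exp_ge_add_one_self[of "4 / c"] A T by (intro mult_mono) (linarith, auto)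
    finally have "real N / real n \<le> exp (4 / c + A / K)" by (simp add: exp_add)
    then have "(real N / real n) ^ n * exp (2 * real n) \<le> exp (4 / c + A / K) ^ n * exp (2 * real n)"
      by (intro mult_right_mono power_mono) auto
    also have "\<dots> = exp (real n * (4 / c + 2 + A / K))"
      by (simp add: exp_of_nat_mult[symmetric] exp_add[symmetric] algebra_simps)
    also have "\<dots> \<le> exp (growth_const R \<delta> * (A + A\<^sup>2 / K))"
    proof -
      define B where "B = 2 * exp 1 * R + 2"
      have B: "B \<ge> 0" unfolding B_def using R by simp
      have "real n \<le> B * A" using n(2) A unfolding B_def by (simp add: algebra_simps)
      then have "real n * (4 / c + 2 + A / K) \<le> (B * A) * (4 / c + 2 + A / K)"
        using c A K by (intro mult_right_mono) auto
      also have "\<dots> \<le> (B * A) * ((4 / c + 2) * (1 + A / K))"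
      proof (intro mult_left_mono)
        have "q + 2 + r \<le> (q + 2) * (1 + r)" if "0 \<le> q" "0 \<le> r" for q r :: real
          using mult_nonneg_nonneg[OF that] that by (simp add: algebra_simps)
        then show "4 / c + 2 + A / K \<le> (4 / c + 2) * (1 + A / K)" using c A K by simp
      qed (use B A in auto)
      also have "\<dots> = growth_const R \<delta> * (A + A\<^sup>2 / K)"
        unfolding growth_const_def c_def[symmetric] B_def[symmetric] by (simp add: algebra_simps power2_eq_square)
      finally show ?thesis by simp
    qed
    finally show ?thesis using sum_binomial_pow2_le[OF n1 nN] by linarith
  qed
  ultimately have "eps_data f \<delta> x0 K * (\<Sum>j\<le>n. real (N choose j) * 2 ^ j) + exp (exp 1 * (R * norm (\<xi> - p)) - real n) * (LINT x|lebesgue. cmod (f x))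
    \<le> eps_data f \<delta> x0 K * exp (growth_const R \<delta> * (A + A\<^sup>2 / K)) + exp (- A) * (LINT x|lebesgue. cmod (f x))"
    using eps0 by (intro add_mono mult_left_mono mult_right_mono) auto
  with main show ?thesis by linarith
qed

section \<open>The stability estimate\<close>

lemma power_le_fact_exp:
  fixes x :: real
  assumes "x \<ge> 0"
  shows "x ^ n \<le> fact n * exp x"
  using sum_exp_series_le[OF assms, of "{n}"] by (simp add: field_simps)

lemma Hm1_norm_sq_eq:
  "Hm1_norm_sq f = (LINT \<xi>|lebesgue. (2 * pi) powr (- 3) * ((cmod (LINT x|lebesgue. f x * cis (- (\<xi> \<bullet> x))))\<^sup>2 / (1 + (norm \<xi>)\<^sup>2)))"
proof -
  have "((2 * pi) powr (- 3 / 2))\<^sup>2 = (2 * pi) powr (- 3)"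
    by (simp add: power2_eq_square powr_add[symmetric])
  then show ?thesis
    unfolding Hm1_norm_sq_def fourier3_def by (simp add: norm_mult power_mult_distrib)
qed

text \<open>Low frequencies contribute the volume of the ball of radius \<open>A\<close> times
  \<open>M\<close>; for high ones Plancherel's factor \<open>(2 * pi) ^ 3\<close> cancels the
  normalisation. The bound \<open>b\<close> is left free to cover both a large cutoff, with
  \<open>b = 1 / A\<^sup>2\<close>, and \<open>A = 0\<close> with \<open>b = 1\<close>.\<close>

lemma Hm1_norm_sq_leI:
  fixes f :: "real^3 \<Rightarrow> complex"
  assumes f: "integrable lebesgue f" and f2: "integrable lebesgue (\<lambda>x. (cmod (f x))\<^sup>2)"
    and M: "0 \<le> M" and A: "0 \<le> A" and b: "0 \<le> b"
    and low: "\<And>\<xi>. norm \<xi> \<le> A \<Longrightarrow> (cmod (LINT x|lebesgue. f x * cis (- (\<xi> \<bullet> x))))\<^sup>2 \<le> M"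
    and high: "\<And>\<xi>::real^3. norm \<xi> > A \<Longrightarrow> 1 / (1 + (norm \<xi>)\<^sup>2) \<le> b"
  shows "Hm1_norm_sq f \<le> M * unit_ball_vol 3 * A ^ 3 + b * L2_norm_sq f"
proof -
  define F where "F \<xi> = (LINT x|lebesgue. f x * cis (- (\<xi> \<bullet> x)))" for \<xi>
  define m where "m = L2_norm_sq f"
  define U where "U = unit_ball_vol 3"
  have m: "m \<ge> 0" unfolding m_def L2_norm_sq_def by simp
  have U: "U \<ge> 0" unfolding U_def by simp
  define w where "w = (2 * pi) powr (- 3)"
  have w: "0 < w" "w \<le> 1" "w * (2 * pi) ^ 3 = 1"
  proof -
    have "w = 1 / (2 * pi) ^ 3" unfolding w_def by (simp add: powr_minus_divide)
    moreover have "1 \<le> (2 * pi) ^ 3" using pi_gt3 by (intro one_le_power) auto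
    ultimately show "0 < w" "w \<le> 1" "w * (2 * pi) ^ 3 = 1" by (auto simp: divide_le_eq)
  qed
  have "F \<in> borel_measurable borel" unfolding F_def by (rule borel_measurable_fourier_lebesgue[OF f])
  then have [measurable]: "F \<in> borel_measurable lebesgue" by (intro measurable_completion) simp
  have [measurable]: "cball 0 A \<in> sets (lebesgue :: (real^3) measure)" by simp
  have "(\<integral>\<^sup>+\<xi>. ennreal (w * ((cmod (F \<xi>))\<^sup>2 / (1 + (norm \<xi>)\<^sup>2))) \<partial>lebesgue)
      \<le> (\<integral>\<^sup>+\<xi>. ennreal M * indicator (cball 0 A) \<xi> + ennreal (w * b) * ennreal ((cmod (F \<xi>))\<^sup>2) \<partial>lebesgue)"
  proof (rule nn_integral_mono)
    fix \<xi> :: "real^3"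
    show "ennreal (w * ((cmod (F \<xi>))\<^sup>2 / (1 + (norm \<xi>)\<^sup>2))) \<le> ennreal M * indicator (cball 0 A) \<xi> + ennreal (w * b) * ennreal ((cmod (F \<xi>))\<^sup>2)"
    proof (cases "norm \<xi> \<le> A")
      case True
      have "(cmod (F \<xi>))\<^sup>2 / (1 + (norm \<xi>)\<^sup>2) \<le> (cmod (F \<xi>))\<^sup>2 / 1"
        by (intro divide_left_mono) (auto simp: add_pos_nonneg)
      also have "\<dots> \<le> M" using low[OF True] unfolding F_def by simp
      finally have "w * ((cmod (F \<xi>))\<^sup>2 / (1 + (norm \<xi>)\<^sup>2)) \<le> 1 * M"
        using w by (intro mult_mono) auto
      then have "ennreal (w * ((cmod (F \<xi>))\<^sup>2 / (1 + (norm \<xi>)\<^sup>2))) \<le> ennreal M * indicator (cball 0 A) \<xi>"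
        using True by (simp add: ennreal_leI)
      then show ?thesis by (rule add_increasing2[rotated]) simp
    next
      case False
      have "(cmod (F \<xi>))\<^sup>2 * (1 / (1 + (norm \<xi>)\<^sup>2)) \<le> (cmod (F \<xi>))\<^sup>2 * b"
        using high[of \<xi>] False by (intro mult_left_mono) auto
      then have "w * ((cmod (F \<xi>))\<^sup>2 * (1 / (1 + (norm \<xi>)\<^sup>2))) \<le> w * ((cmod (F \<xi>))\<^sup>2 * b)"
        using w(1) by (rule mult_left_mono[OF _ less_imp_le])
      then have "w * ((cmod (F \<xi>))\<^sup>2 / (1 + (norm \<xi>)\<^sup>2)) \<le> w * b * (cmod (F \<xi>))\<^sup>2"
        by (simp add: mult_ac)
      then have "ennreal (w * ((cmod (F \<xi>))\<^sup>2 / (1 + (norm \<xi>)\<^sup>2))) \<le> ennreal (w * b) * ennreal ((cmod (F \<xi>))\<^sup>2)"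
        using w b by (subst ennreal_mult[symmetric]) (auto intro: ennreal_leI)
      then show ?thesis by (rule add_increasing[rotated]) simp
    qed
  qed
  also have "\<dots> = ennreal M * emeasure lebesgue (cball 0 A :: (real^3) set) + ennreal (w * b) * (\<integral>\<^sup>+\<xi>. ennreal ((cmod (F \<xi>))\<^sup>2) \<partial>lebesgue)"
    by (subst nn_integral_add) (auto simp: nn_integral_cmult)
  also have "emeasure lebesgue (cball 0 A :: (real^3) set) = ennreal (U * A ^ 3)"
    unfolding U_def using emeasure_cball[OF A, of "0 :: real^3"] by simp
  also have "ennreal (w * b) * (\<integral>\<^sup>+\<xi>. ennreal ((cmod (F \<xi>))\<^sup>2) \<partial>lebesgue) \<le> ennreal (w * b) * ennreal ((2 * pi) ^ DIM(real^3) * m)"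
    unfolding F_def m_def L2_norm_sq_def by (intro mult_left_mono plancherel_le f f2) simp
  also have "ennreal M * ennreal (U * A ^ 3) + \<dots> = ennreal (M * (U * A ^ 3) + (w * b) * ((2 * pi) ^ 3 * m))"
    using M U A m b w by (simp add: ennreal_mult[symmetric] ennreal_plus[symmetric] del: ennreal_plus)
  also have "(w * b) * ((2 * pi) ^ 3 * m) = (w * (2 * pi) ^ 3) * (b * m)" by (simp add: mult_ac)
  also have "\<dots> = b * m" unfolding w(3) by simp
  finally have "(\<integral>\<^sup>+\<xi>. ennreal (w * ((cmod (F \<xi>))\<^sup>2 / (1 + (norm \<xi>)\<^sup>2))) \<partial>lebesgue) \<le> ennreal (M * (U * A ^ 3) + b * m)"
    by (simp add: add_left_mono)
  then have "(LINT \<xi>|lebesgue. w * ((cmod (F \<xi>))\<^sup>2 / (1 + (norm \<xi>)\<^sup>2))) \<le> M * (U * A ^ 3) + b * m"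
    using M U A m b by (intro integral_real_bounded) auto
  then show ?thesis unfolding Hm1_norm_sq_eq F_def w_def m_def U_def by (simp add: mult_ac)
qed

text \<open>Collects the coefficients of the next estimate: \<open>12 = 2 * fact 3\<close> from the
  amplified data, \<open>240 = 2 * fact 5\<close> from the truncation error and 1 from the high
  frequencies.\<close>

definition split_const :: "real \<Rightarrow> real" where
  "split_const R = 12 * unit_ball_vol 3 + 240 * (unit_ball_vol 3 * measure lebesgue (cball 0 R :: (real^3) set)) + 1"

lemma Hm1_norm_sq_le_split:
  fixes f :: "real^3 \<Rightarrow> complex"
  assumes R: "R \<ge> 1" and \<delta>: "\<delta> > 0" and x0: "x0 \<in> sphere2" and K: "K > 1" and A: "A \<ge> 1"
    and f: "f \<in> borel_measurable lebesgue" and f2: "integrable lebesgue (\<lambda>x. (cmod (f x))\<^sup>2)"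
    and supp: "\<And>x. f x \<noteq> 0 \<Longrightarrow> norm x \<le> R"
  shows "Hm1_norm_sq f \<le> split_const R *
    ((eps_data f \<delta> x0 K)\<^sup>2 * exp ((2 * growth_const R \<delta> + 1) * (A + A\<^sup>2 / K)) + L2_norm_sq f / A\<^sup>2)"
proof -
  define g where "g = growth_const R \<delta>"
  define V where "V = measure lebesgue (cball 0 R :: (real^3) set)"
  define U where "U = unit_ball_vol 3"
  have V: "V \<ge> 0" unfolding V_def by simp
  have U: "U \<ge> 0" unfolding U_def by simp
  have UV: "U * V \<ge> 0" using U V by simp
  define e where "e = eps_data f \<delta> x0 K"
  define m where "m = L2_norm_sq f"
  define X where "X = A + A\<^sup>2 / K"
  have m: "m \<ge> 0" unfolding m_def L2_norm_sq_def by simp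
  have X: "X \<ge> A" unfolding X_def using A K by simp
  have int: "integrable lebesgue f" by (rule integrable_of_square_integrable[OF f f2 supp])
  have L1: "(LINT x|lebesgue. cmod (f x))\<^sup>2 \<le> V * m"
    unfolding V_def m_def L2_norm_sq_def by (rule L1_norm_le_L2_norm[OF f f2 supp])
  \<comment> \<open>Comes from \<open>(a + b)\<^sup>2 \<le> 2 * a\<^sup>2 + 2 * b\<^sup>2\<close>
    applied to the extrapolation bound, with the L1 norm replaced by the L2 norm.\<close>
  define M where "M = 2 * (e\<^sup>2 * exp (2 * g * X)) + 2 * (exp (- 2 * A) * (V * m))"
  have M: "M \<ge> 0" unfolding M_def using V m by simp
  have "Hm1_norm_sq f \<le> M * unit_ball_vol 3 * A ^ 3 + (1 / A\<^sup>2) * L2_norm_sq f"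
  proof (rule Hm1_norm_sq_leI[OF int f2 M])
    fix \<xi> :: "real^3"
    assume \<xi>: "norm \<xi> \<le> A"
    have "(cmod (LINT x|lebesgue. f x * cis (- (\<xi> \<bullet> x))))\<^sup>2
      \<le> (e * exp (g * X) + exp (- A) * (LINT x|lebesgue. cmod (f x)))\<^sup>2"
      unfolding e_def g_def X_def
      by (intro power_mono fourier_le_eps_data R \<delta> x0 K A int supp \<xi>) auto
    also have "\<dots> \<le> 2 * (e * exp (g * X))\<^sup>2 + 2 * (exp (- A) * (LINT x|lebesgue. cmod (f x)))\<^sup>2"
      using sum_squares_bound[of "e * exp (g * X)" "exp (- A) * (LINT x|lebesgue. cmod (f x))"]
      by (simp add: power2_sum)
    also have "(e * exp (g * X))\<^sup>2 = e\<^sup>2 * exp (2 * g * X)"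
      by (simp add: power_mult_distrib exp_double[symmetric] mult_ac)
    also have "(exp (- A) * (LINT x|lebesgue. cmod (f x)))\<^sup>2 = exp (- 2 * A) * (LINT x|lebesgue. cmod (f x))\<^sup>2"
      by (simp add: power_mult_distrib exp_double[symmetric])
    also have "2 * (e\<^sup>2 * exp (2 * g * X)) + 2 * (exp (- 2 * A) * (LINT x|lebesgue. cmod (f x))\<^sup>2) \<le> M"
      unfolding M_def using L1 by (intro add_left_mono mult_left_mono) auto
    finally show "(cmod (LINT x|lebesgue. f x * cis (- (\<xi> \<bullet> x))))\<^sup>2 \<le> M" by simp
  next
    fix \<xi> :: "real^3"
    assume "norm \<xi> > A"
    then have "A\<^sup>2 \<le> (norm \<xi>)\<^sup>2" using A by (intro power_mono) auto
    then show "1 / (1 + (norm \<xi>)\<^sup>2) \<le> 1 / A\<^sup>2" using A by (intro divide_left_mono mult_pos_pos) (linarith, auto simp: add_pos_nonneg)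
  qed (use A in auto)
  also have "M * unit_ball_vol 3 * A ^ 3 = 2 * U * e\<^sup>2 * (A ^ 3 * exp (2 * g * X)) + 2 * (U * V) * m * (A ^ 3 * exp (- 2 * A))"
    unfolding M_def U_def by (simp add: algebra_simps)
  \<comment> \<open>The volume factor \<open>A ^ 3\<close> is absorbed at the cost of one more
    \<open>X\<close> in the exponent.\<close>
  also have "A ^ 3 * exp (2 * g * X) \<le> 6 * exp ((2 * g + 1) * X)"
  proof -
    have "A ^ 3 \<le> fact 3 * exp A" using A by (intro power_le_fact_exp) auto
    also have "\<dots> \<le> 6 * exp X" using X by (simp add: fact_numeral)
    finally have "A ^ 3 * exp (2 * g * X) \<le> 6 * exp X * exp (2 * g * X)" by (rule mult_right_mono) simp
    also have "\<dots> = 6 * exp ((2 * g + 1) * X)" by (simp only: mult.assoc exp_add[symmetric]) (simp add: algebra_simps)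
    finally show ?thesis .
  qed
  \<comment> \<open>The truncation error decays exponentially in \<open>A\<close>, so even with the
    volume factor it is of the same order as the high-frequency term.\<close>
  also have "A ^ 3 * exp (- 2 * A) \<le> 120 / A\<^sup>2"
  proof -
    have "A ^ 5 \<le> fact 5 * exp A" using A by (intro power_le_fact_exp) auto
    then have "A ^ 5 * exp (- 2 * A) \<le> (fact 5 * exp A) * exp (- 2 * A)" by (intro mult_right_mono) auto
    also have "\<dots> = 120 * exp (- A)" by (simp add: exp_add[symmetric] fact_numeral)
    also have "\<dots> \<le> 120" using A by simp
    finally have "A ^ 3 * exp (- 2 * A) * A\<^sup>2 \<le> 120" by (simp add: power_add[symmetric] mult_ac)
    then show ?thesis using A by (simp add: pos_le_divide_eq)
  qed
  finally have "Hm1_norm_sq f \<le> 2 * U * e\<^sup>2 * (6 * exp ((2 * g + 1) * X)) + 2 * (U * V) * m * (120 / A\<^sup>2) + 1 / A\<^sup>2 * m"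
    using U UV m unfolding m_def by (simp add: mult_left_mono)
  also have "\<dots> = 12 * U * (e\<^sup>2 * exp ((2 * g + 1) * X)) + (240 * (U * V) + 1) * (m / A\<^sup>2)"
    by (simp add: algebra_simps)
  also have "\<dots> \<le> (12 * U + 240 * (U * V) + 1) * (e\<^sup>2 * exp ((2 * g + 1) * X)) + (12 * U + 240 * (U * V) + 1) * (m / A\<^sup>2)"
    using U UV m by (intro add_mono mult_right_mono) auto
  finally show "Hm1_norm_sq f \<le> split_const R * ((eps_data f \<delta> x0 K)\<^sup>2 * exp ((2 * growth_const R \<delta> + 1) * (A + A\<^sup>2 / K)) + L2_norm_sq f / A\<^sup>2)"
    unfolding e_def m_def X_def g_def split_const_def U_def[symmetric] V_def[symmetric] by (simp only: distrib_left)
qed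

text \<open>The splitting at \<open>A = 0\<close>, where the low-frequency ball has volume zero. It
  serves the case of a cutoff below 1.\<close>

lemma Hm1_norm_sq_le_L2_norm_sq:
  fixes f :: "real^3 \<Rightarrow> complex"
  assumes f: "f \<in> borel_measurable lebesgue" and f2: "integrable lebesgue (\<lambda>x. (cmod (f x))\<^sup>2)"
    and supp: "\<And>x. f x \<noteq> 0 \<Longrightarrow> norm x \<le> R"
  shows "Hm1_norm_sq f \<le> L2_norm_sq f"
proof -
  have int: "integrable lebesgue f" by (rule integrable_of_square_integrable[OF f f2 supp])
  have "Hm1_norm_sq f \<le> (LINT x|lebesgue. cmod (f x))\<^sup>2 * unit_ball_vol 3 * 0 ^ 3 + 1 * L2_norm_sq f"
    by (rule Hm1_norm_sq_leI[OF int f2]) (auto intro!: power_mono cmod_fourier_le_L1 simp: divide_le_eq add_pos_nonneg)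
  then show ?thesis by simp
qed

text \<open>The two products are \<open>A\<close> and \<open>A\<^sup>2 / K\<close> for the final
  cutoff. In \<open>T = max K L > 1\<close> they have degrees 11/12 and 5/6, both below 1, so the
  linear term \<open>T \<le> K + L\<close> dominates them up to a constant: with
  \<open>t = T powr (1/12)\<close>, compare \<open>t\<close> with \<open>2 * c\<close>.\<close>

lemma young_powr_bound:
  fixes K L c :: real
  assumes K: "K > 1" and L: "L > 0" and c: "c \<ge> 0"
  shows "c * (K powr (2/3) * L powr (1/4) + K powr (1/3) * L powr (1/2)) \<le> K + L + (2 * c) ^ 12"
proof -
  define T where "T = max K L"
  have T: "T > 1" "K \<le> T" "L \<le> T" unfolding T_def using K by auto
  have "K powr (2/3) * L powr (1/4) \<le> T powr (2/3) * T powr (1/4)"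
    using K L T by (intro mult_mono powr_mono2) auto
  also have "\<dots> = T powr (11/12)" by (simp add: powr_add[symmetric])
  finally have 1: "K powr (2/3) * L powr (1/4) \<le> T powr (11/12)" .
  have "K powr (1/3) * L powr (1/2) \<le> T powr (1/3) * T powr (1/2)"
    using K L T by (intro mult_mono powr_mono2) auto
  also have "\<dots> = T powr (5/6)" by (simp add: powr_add[symmetric])
  also have "\<dots> \<le> T powr (11/12)" using T by (intro powr_mono) auto
  finally have "K powr (2/3) * L powr (1/4) + K powr (1/3) * L powr (1/2) \<le> 2 * T powr (11/12)"
    using 1 by simp
  then have 2: "c * (K powr (2/3) * L powr (1/4) + K powr (1/3) * L powr (1/2)) \<le> 2 * c * T powr (11/12)"
    using mult_left_mono[OF _ c] by fastforce
  define t where "t = T powr (1/12)"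
  have t: "t > 0" unfolding t_def using T by simp
  have t12: "t ^ 12 = T" and t11: "t ^ 11 = T powr (11/12)"
    unfolding t_def using T by (simp_all add: powr_realpow[symmetric] powr_powr)
  have "2 * c * t ^ 11 \<le> t ^ 12 + (2 * c) ^ 12"
  proof (cases "2 * c \<le> t")
    case True
    then have "2 * c * t ^ 11 \<le> t * t ^ 11" using t by (intro mult_right_mono) auto
    also have "\<dots> = t ^ 12" by (simp add: power_Suc[symmetric] del: power_Suc)
    finally show ?thesis using c by (simp add: add_increasing2)
  next
    case False
    then have "2 * c * t ^ 11 \<le> 2 * c * (2 * c) ^ 11" using t c by (intro mult_left_mono power_mono) auto
    also have "\<dots> = (2 * c) ^ 12" by (simp add: power_Suc[symmetric] del: power_Suc)
    finally show ?thesis using t by (simp add: add_increasing)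
  qed
  then have "2 * c * T powr (11/12) \<le> T + (2 * c) ^ 12" unfolding t12 t11 .
  with 2 have "c * (K powr (2/3) * L powr (1/4) + K powr (1/3) * L powr (1/2)) \<le> T + (2 * c) ^ 12" by linarith
  then show ?thesis unfolding T_def using K L by linarith
qed

theorem theorem2:
  fixes R \<delta> :: real
  assumes "R \<ge> 1" and "\<delta> > 0"
  shows "\<exists>\<alpha>::real. 0 < \<alpha> \<and> \<alpha> < 1 \<and>
    (\<forall>x0 \<in> sphere2. \<exists>C::real. C > 0 \<and>
      (\<forall>(K::real) (f :: real^3 \<Rightarrow> complex).
        K > 1 \<longrightarrow>
        f \<in> borel_measurable lebesgue \<longrightarrow>
        integrable lebesgue (\<lambda>x. (cmod (f x))\<^sup>2) \<longrightarrow>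
        closure {x. f x \<noteq> 0} \<subseteq> ball 0 R \<longrightarrow>
        eps_data f \<delta> x0 K < 1 \<longrightarrow>
        Hm1_norm_sq f \<le> C * (K ^ 3 * exp (2 * K * (1 - \<alpha>)) * eps_data f \<delta> x0 K powr (2 * \<alpha>)
            + L2_norm_sq f / (K powr (4/3) * \<bar>ln (eps_data f \<delta> x0 K)\<bar> powr (1/2)))))"
proof -
  define C where "C = split_const R"
  define c where "c = 2 * growth_const R \<delta> + 1"
  have C: "C \<ge> 1" unfolding C_def split_const_def by simp
  have "growth_const R \<delta> \<ge> 0" unfolding growth_const_def using assms by (intro mult_nonneg_nonneg) auto
  then have c: "c \<ge> 0" unfolding c_def by simp
  \<comment> \<open>Absorbs the additive constant of \<open>young_powr_bound\<close> once it stands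
    in an exponent.\<close>
  define D where "D = exp ((2 * c) ^ 12)"
  have D: "D \<ge> 1" unfolding D_def using c by simp
  \<comment> \<open>For \<alpha> = 1/2 the exponential is \<open>exp K\<close> and the data enter to
    the first power.\<close>
  have main: "Hm1_norm_sq f \<le> (C * D) * (K ^ 3 * exp (2 * K * (1 - 1/2)) * eps_data f \<delta> x0 K powr (2 * (1/2))
            + L2_norm_sq f / (K powr (4/3) * \<bar>ln (eps_data f \<delta> x0 K)\<bar> powr (1/2)))"
    if x0: "x0 \<in> sphere2" and K: "K > 1" and f: "f \<in> borel_measurable lebesgue"
      and f2: "integrable lebesgue (\<lambda>x. (cmod (f x))\<^sup>2)" and cl: "closure {x. f x \<noteq> 0} \<subseteq> ball 0 R"
      and e1: "eps_data f \<delta> x0 K < 1" for x0 K and f :: "real^3 \<Rightarrow> complex"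
  proof -
    have supp: "norm x \<le> R" if "f x \<noteq> 0" for x
      using cl closure_subset[of "{x. f x \<noteq> 0}"] that by force
    define e where "e = eps_data f \<delta> x0 K"
    define m where "m = L2_norm_sq f"
    have m: "m \<ge> 0" unfolding m_def L2_norm_sq_def by simp
    have e0: "e \<ge> 0" unfolding e_def
    proof (rule order_trans[OF norm_ge_zero far_field_le_eps_data])
      show "x0 \<in> Vdelta \<delta> x0" unfolding Vdelta_def using x0 assms by simp
      show "(0::real) < 1 / 2" "1 / 2 < K" using K by auto
    qed
    note H = Hm1_norm_sq_le_split[OF assms x0 K _ f f2 supp, folded e_def m_def C_def c_def]
    have CD: "1 \<le> C * D" "C \<le> C * D" using mult_mono[OF C D] mult_left_mono[OF D, of C] C D by auto
    show ?thesis
    proof (cases "e = 0")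
      case True
      \<comment> \<open>Here \<open>ln 0 = 0\<close> and \<open>x / 0 = 0\<close> make the right-hand side vanish, so \<open>f\<close> must vanish in \<open>H\<^sup>-\<^sup>1\<close>.\<close>
      have "((\<lambda>A::real. C * (m / A\<^sup>2)) \<longlongrightarrow> 0) at_top"
        by (intro tendsto_mult_right_zero tendsto_divide_0[OF tendsto_const] filterlim_at_top_imp_at_infinity
            filterlim_pow_at_top filterlim_ident) simp
      \<comment> \<open>With \<open>e = 0\<close> the data term of \<open>H\<close> vanishes for
        every cutoff, so \<open>A\<close> may tend to infinity.\<close>
      then have "Hm1_norm_sq f \<le> 0"
        by (rule tendsto_lowerbound) (use H True in \<open>auto intro!: eventually_mono[OF eventually_ge_at_top[of 1]]\<close>)
      then show ?thesis using True unfolding e_def by simp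
    next
      case False
      then have e: "0 < e" "e < 1" using e0 e1 unfolding e_def by auto
      define L where "L = - ln e"
      have L: "L > 0" "\<bar>ln e\<bar> = L" "e = exp (- L)" unfolding L_def using e by (auto simp: ln_less_zero)
      \<comment> \<open>Chosen so that \<open>m / A\<^sup>2\<close> is exactly the second term of
        the claim.\<close>
      define A where "A = K powr (2/3) * L powr (1/4)"
      have A0: "A > 0" unfolding A_def using K L by simp
      have A2: "A\<^sup>2 = K powr (4/3) * L powr (1/2)"
        unfolding A_def using K L by (simp add: power_mult_distrib powr_realpow[symmetric] powr_powr)
      have A2K: "A\<^sup>2 / K = K powr (1/3) * L powr (1/2)"
      proof -
        have "K powr (4/3) = K powr (1/3) * K" using K powr_add[of K "1/3" 1] by simp
        then show ?thesis unfolding A2 using K by simp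
      qed
      have "Hm1_norm_sq f \<le> (C * D) * (K ^ 3 * exp K * e + m / A\<^sup>2)"
      proof (cases "A \<ge> 1")
        case True
        have "e\<^sup>2 * exp (c * (A + A\<^sup>2 / K)) \<le> D * (K ^ 3 * exp K * e)"
        proof -
          \<comment> \<open>One factor \<open>e = exp (- L)\<close> cancels the \<open>L\<close>
            from \<open>young_powr_bound\<close>; the other remains as the power of the data in the
            claim.\<close>
          have "e\<^sup>2 * exp (c * (A + A\<^sup>2 / K)) = e * exp (- L + c * (A + A\<^sup>2 / K))"
            unfolding exp_add L(3)[symmetric] by (simp add: power2_eq_square)
          also have "\<dots> \<le> e * exp (K + (2 * c) ^ 12)"
            using young_powr_bound[OF K L(1) c] e unfolding A2K unfolding A_def by (intro mult_left_mono) auto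
          also have "\<dots> = 1 * (D * (exp K * e))" unfolding D_def by (simp add: exp_add)
          also have "\<dots> \<le> K ^ 3 * (D * (exp K * e))" using K D e by (intro mult_right_mono) auto
          finally show ?thesis by (simp add: mult_ac)
        qed
        moreover have "m / A\<^sup>2 \<le> D * (m / A\<^sup>2)" using D m mult_right_mono[of 1 D "m / A\<^sup>2"] by simp
        ultimately have "C * (e\<^sup>2 * exp (c * (A + A\<^sup>2 / K)) + m / A\<^sup>2) \<le> C * (D * (K ^ 3 * exp K * e) + D * (m / A\<^sup>2))"
          using C by (intro mult_left_mono add_mono) auto
        with H[OF True] show ?thesis by (simp add: algebra_simps)
      next
        case False
        have "Hm1_norm_sq f \<le> m" unfolding m_def by (rule Hm1_norm_sq_le_L2_norm_sq[OF f f2 supp])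
        also have "m \<le> m / A\<^sup>2" using False A0 m by (simp add: le_divide_eq mult_left_le power_le_one)
        also have "\<dots> \<le> K ^ 3 * exp K * e + m / A\<^sup>2" using K e by simp
        also have "\<dots> \<le> (C * D) * (K ^ 3 * exp K * e + m / A\<^sup>2)"
          using mult_right_mono[OF CD(1), of "K ^ 3 * exp K * e + m / A\<^sup>2"] K e m by simp
        finally show ?thesis .
      qed
      then show ?thesis using e unfolding A2 L(2)[symmetric] unfolding e_def m_def by simp
    qed
  qed
  have "C * D > 0" using C D by (intro mult_pos_pos) auto
  \<comment> \<open>The constant \<open>C * D\<close> depends only on \<open>R\<close> and \<delta>,
    so the same one serves every \<open>x0\<close>.\<close>
  then show ?thesis by (intro exI[of _ "1/2"] conjI ballI exI[of _ "C * D"] allI impI main) auto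
qed

end
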